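(* Let $\Sigma\subseteq\Sigma'$ be two simplicial complexes, and let $\mathcal A_\Sigma=\{\Sigma_i\}_{i\in I}$, $\mathcal A_{\Sigma'}=\{\Sigma'_i\}_{i\in I'}$ be finite covers of subcomplexes for $\Sigma$ and $\Sigma'$ such that $I\subseteq I'$ and $\Sigma_i\subseteq\Sigma'_i$ for each $i\in I$. In particular, $\operatorname{card}(I')<\infty$. Suppose that for each finite subset $\sigma\subseteq I'$, the intersection $\bigcap_{i\in\sigma}\Sigma'_i$ is either empty or contractible (and likewise for $\bigcap_{i\in\sigma}\Sigma_i$, for finite $\sigma\subseteq I$). Then $|\Sigma|\simeq|\mathcal N(\mathcal A_\Sigma)|$ and $|\Sigma'|\simeq|\mathcal N(\mathcal A_{\Sigma'})|$, via maps that commute up to homotopy with the canonical inclusions; i.e. there are homotopy equivalences $f:|\Sigma|\to|\mathcal N(\mathcal A_\Sigma)|$ and $f':|\Sigma'|\to|\mathcal N(\mathcal A_{\Sigma'})|$ such that $f'\circ|\iota|$ is homotopic to $|\iota_{\mathcal N}|\circ f$, where $\iota:\Sigma\hookrightarrow\Sigma'$ and $\iota_{\mathcal N}:\mathcal N(\mathcal A_\Sigma)\hookrightarrow\mathcal N(\mathcal A_{\Sigma'})$ are the inclusions.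
   Context: A collection of subcomplexes $\{\Sigma_i\}_{i\in I}$ of a simplicial complex $\Sigma$ is a cover of subcomplexes for $\Sigma$ if $\Sigma=\bigcup_{i\in I}\Sigma_i$. For a family $\mathcal A=\{A_i\}_{i\in I}$ of nonempty sets, the nerve is the simplicial complex $\mathcal N(\mathcal A)=\{\sigma\subseteq I:\sigma\text{ finite, nonempty, and }\bigcap_{i\in\sigma}A_i\neq\varnothing\}$ (members of a cover are nonempty subcomplexes). Subsets $\sigma$ indexing intersections are nonempty. A simplicial complex is contractible if its geometric realization is. $|\Sigma|$ denotes the geometric realization with the weak topology, and $|f|$ the map induced by a simplicial map $f$. *)

theory Defs
  imports "HOL-Analysis.Analysis"
begin

definition abstract_simplicial_complex :: "'v set set \<Rightarrow> bool"
  where "abstract_simplicial_complex K \<longleftrightarrow>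
    (\<forall>s\<in>K. finite s \<and> s \<noteq> {}) \<and>
    (\<forall>s\<in>K. \<forall>t. t \<subseteq> s \<and> t \<noteq> {} \<longrightarrow> t \<in> K)"

definition subcomplex :: "'v set set \<Rightarrow> 'v set set \<Rightarrow> bool"
  where "subcomplex L K \<longleftrightarrow> abstract_simplicial_complex L \<and> L \<subseteq> K"

definition subcomplex_cover :: "'v set set \<Rightarrow> 'i set \<Rightarrow> ('i \<Rightarrow> 'v set set) \<Rightarrow> bool"
  where "subcomplex_cover K I A \<longleftrightarrow>
    (\<forall>i\<in>I. subcomplex (A i) K \<and> A i \<noteq> {}) \<and> K = (\<Union>i\<in>I. A i)"

definition nerve :: "'i set \<Rightarrow> ('i \<Rightarrow> 'a set) \<Rightarrow> 'i set set"
  where "nerve I A = {\<sigma>. \<sigma> \<subseteq> I \<and> finite \<sigma> \<and> \<sigma> \<noteq> {} \<and> (\<Inter>i\<in>\<sigma>. A i) \<noteq> {}}"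

text \<open>Points of a realization are given by their barycentric coordinates, extended by zero to
  all of \<open>'v\<close>.\<close>

definition closed_cell :: "'v set \<Rightarrow> ('v \<Rightarrow> real) set"
  where "closed_cell s = {x. (\<forall>v. 0 \<le> x v) \<and> (\<forall>v. v \<notin> s \<longrightarrow> x v = 0) \<and> (\<Sum>v\<in>s. x v) = 1}"

text \<open>The weak topology. On a single cell, which is supported in a finite set of coordinates, the
  product topology of \<open>'v \<Rightarrow> real\<close> (its \<open>topological_space\<close> instance) restricts to the
  usual topology of a Euclidean simplex.\<close>

definition realization :: "'v set set \<Rightarrow> ('v \<Rightarrow> real) topology"
  where "realization K = topology (\<lambda>U. U \<subseteq> (\<Union>s\<in>K. closed_cell s) \<and>
    (\<forall>s\<in>K. openin (top_of_set (closed_cell s)) (U \<inter> closed_cell s)))"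

lemma openin_realization:
  "openin (realization K) U \<longleftrightarrow> U \<subseteq> (\<Union>s\<in>K. closed_cell s) \<and>
    (\<forall>s\<in>K. openin (top_of_set (closed_cell s)) (U \<inter> closed_cell s))"
proof -
  have "istopology (\<lambda>U. U \<subseteq> (\<Union>s\<in>K. closed_cell s) \<and>
    (\<forall>s\<in>K. openin (top_of_set (closed_cell s)) (U \<inter> closed_cell s)))"
    unfolding istopology_def
  proof (intro conjI allI impI ballI)
    fix S T :: "('a \<Rightarrow> real) set" and s
    assume "S \<subseteq> (\<Union>s\<in>K. closed_cell s) \<and>
        (\<forall>s\<in>K. openin (top_of_set (closed_cell s)) (S \<inter> closed_cell s))"
      and "T \<subseteq> (\<Union>s\<in>K. closed_cell s) \<and>
        (\<forall>s\<in>K. openin (top_of_set (closed_cell s)) (T \<inter> closed_cell s))"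
      and "s \<in> K"
    then have "openin (top_of_set (closed_cell s)) ((S \<inter> closed_cell s) \<inter> (T \<inter> closed_cell s))"
      by (simp add: openin_Int)
    moreover have "(S \<inter> closed_cell s) \<inter> (T \<inter> closed_cell s) = S \<inter> T \<inter> closed_cell s"
      by blast
    ultimately show "openin (top_of_set (closed_cell s)) (S \<inter> T \<inter> closed_cell s)"
      by simp
  next
    fix \<K> :: "('a \<Rightarrow> real) set set" and s
    assume "\<forall>S\<in>\<K>. S \<subseteq> (\<Union>s\<in>K. closed_cell s) \<and>
        (\<forall>s\<in>K. openin (top_of_set (closed_cell s)) (S \<inter> closed_cell s))"
      and "s \<in> K"
    then have "openin (top_of_set (closed_cell s)) (\<Union>S\<in>\<K>. S \<inter> closed_cell s)"
      by (intro openin_Union) auto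
    then show "openin (top_of_set (closed_cell s)) (\<Union>\<K> \<inter> closed_cell s)"
      by (simp only: Int_Union2)
  qed (simp_all add: Union_least le_infI1)
  then show ?thesis
    by (simp add: realization_def)
qed

lemma topspace_realization: "topspace (realization K) = (\<Union>s\<in>K. closed_cell s)"
proof
  show "topspace (realization K) \<subseteq> (\<Union>s\<in>K. closed_cell s)"
    by (metis openin_realization openin_topspace)
  have "openin (realization K) (\<Union>s\<in>K. closed_cell s)"
    unfolding openin_realization
  proof (intro conjI ballI subset_refl)
    fix s assume "s \<in> K"
    then have "(\<Union>s\<in>K. closed_cell s) \<inter> closed_cell s = closed_cell s"
      by blast
    then show "openin (top_of_set (closed_cell s)) ((\<Union>s\<in>K. closed_cell s) \<inter> closed_cell s)"
      by simp
  qed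
  then show "(\<Union>s\<in>K. closed_cell s) \<subseteq> topspace (realization K)"
    by (rule openin_subset)
qed

definition contractible_complex :: "'v set set \<Rightarrow> bool"
  where "contractible_complex K \<longleftrightarrow> contractible_space (realization K)"

text \<open>The map of realizations induced by a simplicial map with vertex map \<open>f\<close>: the affine
  extension of \<open>f\<close> on every cell. The sum is finite at points of a realization.\<close>

definition realization_map :: "('v \<Rightarrow> 'w) \<Rightarrow> ('v \<Rightarrow> real) \<Rightarrow> ('w \<Rightarrow> real)"
  where "realization_map f x = (\<lambda>w. \<Sum>v | x v \<noteq> 0 \<and> f v = w. x v)"

text \<open>In particular, the inclusion of a subcomplex, whose vertex map is \<open>id\<close>, induces the
  inclusion of realizations.\<close>

lemma realization_map_id: "realization_map id = id"
proof (intro ext)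
  fix x :: "'v \<Rightarrow> real" and w
  have "{v. x v \<noteq> 0 \<and> id v = w} = (if x w = 0 then {} else {w})"
    by auto
  then show "realization_map id x w = id x w"
    by (simp add: realization_map_def)
qed

definition homotopy_equivalence_map ::
    "'a topology \<Rightarrow> 'b topology \<Rightarrow> ('a \<Rightarrow> 'b) \<Rightarrow> bool"
  where "homotopy_equivalence_map X Y f \<longleftrightarrow>
    continuous_map X Y f \<and>
    (\<exists>g. continuous_map Y X g \<and>
         homotopic_with (\<lambda>x. True) X X (g \<circ> f) id \<and>
         homotopic_with (\<lambda>x. True) Y Y (f \<circ> g) id)"

lemma homotopy_equivalent_space_iff_map:
  "X homotopy_equivalent_space Y \<longleftrightarrow> (\<exists>f. homotopy_equivalence_map X Y f)"
  by (auto simp: homotopy_equivalent_space_def homotopy_equivalence_map_def)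

end

theory Submission
  imports Defs
begin

text \<open>The proof is by acyclic carriers. If every simplex \<open>s\<close> of \<open>M\<close> is assigned a contractible
  subcomplex \<open>\<Phi> s\<close> of \<open>L\<close>, monotonically in \<open>s\<close>, then there is a map \<open>|M| \<rightarrow> |L|\<close> taking each cell
  \<open>s\<close> into \<open>|\<Phi> s|\<close>, and any two such maps are homotopic.

  Write \<open>N\<close> for the nerve and \<open>sd\<close> for barycentric subdivision. Carriers give mutually inverse homotopy
  equivalences \<open>p : |K| \<rightarrow> |sd K|\<close> and \<open>q : |sd K| \<rightarrow> |K|\<close> (and likewise for \<open>N\<close>). Sending a simplex of \<open>K\<close>
  to the set of indices of the cover members containing it reverses inclusions, hence is a simplicial
  map \<open>m : sd K \<rightarrow> sd N\<close>. In the other direction, a chain of \<open>N\<close> with least member \<open>\<sigma>\<close> is carried by the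
  contractible intersection over \<open>\<sigma>\<close>, which gives \<open>g : |sd N| \<rightarrow> |K|\<close>. The composite \<open>g \<circ> |m|\<close> is
  homotopic to \<open>q\<close> because both take a chain with greatest member \<open>s\<close> into the intersection of all
  cover members containing \<open>s\<close>; the composite \<open>|m| \<circ> p \<circ> g\<close> is homotopic to the identity
  because both take a chain with least member \<open>\<sigma>\<close> into the subdivided complex of simplices above \<open>\<sigma>\<close>,
  a cone. So \<open>f = q \<circ> |m| \<circ> p\<close> is a homotopy equivalence, and each of its three factors commutes up
  to homotopy with the inclusions, again by a common carrier.\<close>

subsection \<open>The weak topology\<close>

lemma closed_cell_empty [simp]: "closed_cell {} = {}"
  by (simp add: closed_cell_def)

lemma closed_cell_mono:
  assumes "finite t" "s \<subseteq> t"
  shows "closed_cell s \<subseteq> closed_cell t"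
proof
  fix x assume x: "x \<in> closed_cell s"
  have "sum x t = sum x s"
    using x assms by (intro sum.mono_neutral_right) (auto simp: closed_cell_def)
  then show "x \<in> closed_cell t"
    using x assms by (auto simp: closed_cell_def)
qed

text \<open>At a point of a realization this is the unique simplex whose open cell contains the
  point; arguments over overlapping cells reduce to comparing supports.\<close>

definition supp :: "('v \<Rightarrow> real) \<Rightarrow> 'v set"
  where "supp x = {v. x v \<noteq> 0}"

lemma supp_subset: "x \<in> closed_cell s \<Longrightarrow> supp x \<subseteq> s"
  by (auto simp: closed_cell_def supp_def)

lemma closed_cell_supp:
  assumes "finite s" "x \<in> closed_cell s"
  shows "x \<in> closed_cell (supp x)"
proof -
  have "sum x s = sum x (supp x)"
    using assms supp_subset[of x s] by (intro sum.mono_neutral_right) (auto simp: supp_def)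
  then show ?thesis
    using assms by (auto simp: closed_cell_def supp_def)
qed

lemma closed_cell_iff_supp:
  assumes "finite s" "x \<in> closed_cell s" "finite t"
  shows "x \<in> closed_cell t \<longleftrightarrow> supp x \<subseteq> t"
proof
  show "supp x \<subseteq> t" if "x \<in> closed_cell t" using supp_subset[OF that] .
  show "x \<in> closed_cell t" if "supp x \<subseteq> t"
    using closed_cell_supp[OF assms(1,2)] closed_cell_mono[OF assms(3) that] by (rule subsetD[rotated])
qed

lemma supp_nonempty: "x \<in> closed_cell s \<Longrightarrow> finite s \<Longrightarrow> supp x \<noteq> {}"
  by (metis closed_cell_supp closed_cell_empty empty_iff)

lemma closed_closed_cell: "closed (closed_cell s)"
proof -
  have eq: "closed_cell s = (\<Inter>v. {x. 0 \<le> x v}) \<inter> (\<Inter>v\<in>-s. {x. x v = 0}) \<inter> {x. sum x s = 1}"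
    unfolding closed_cell_def by blast
  have "closed {x::'a \<Rightarrow> real. 0 \<le> x v}" for v
    by (rule closed_Collect_le[OF continuous_on_const continuous_on_product_coordinates])
  moreover have "closed {x::'a \<Rightarrow> real. x v = 0}" for v
    by (rule closed_Collect_eq[OF continuous_on_product_coordinates continuous_on_const])
  moreover have "closed {x::'a \<Rightarrow> real. sum x s = 1}"
    by (rule closed_Collect_eq[OF continuous_on_sum[OF continuous_on_product_coordinates] continuous_on_const])
  ultimately show ?thesis
    unfolding eq by (intro closed_Int closed_INT ballI)
qed

lemma complexD:
  assumes "abstract_simplicial_complex K" "s \<in> K"
  shows "finite s" "s \<noteq> {}" "t \<subseteq> s \<Longrightarrow> t \<noteq> {} \<Longrightarrow> t \<in> K"
proof -
  note K = assms(1)[unfolded abstract_simplicial_complex_def]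
  show "finite s" "s \<noteq> {}"
    using bspec[OF conjunct1[OF K] assms(2)] by auto
  show "t \<in> K" if "t \<subseteq> s" "t \<noteq> {}"
    using bspec[OF conjunct2[OF K] assms(2)] that by blast
qed

lemma supp_in_complex:
  assumes K: "abstract_simplicial_complex K" and x: "x \<in> topspace (realization K)"
  shows "supp x \<in> K" "x \<in> closed_cell (supp x)"
proof -
  obtain s where s: "s \<in> K" "x \<in> closed_cell s"
    using x unfolding topspace_realization by blast
  note fs = complexD(1)[OF K s(1)]
  show "supp x \<in> K"
    using complexD(3)[OF K s(1) supp_subset[OF s(2)] supp_nonempty[OF s(2) fs]] .
  show "x \<in> closed_cell (supp x)"
    using closed_cell_supp[OF fs s(2)] .
qed

text \<open>The universal property of the weak topology: openness of a preimage is tested cell by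
  cell.\<close>

lemma continuous_map_from_realization:
  "continuous_map (realization K) Y f \<longleftrightarrow>
    (\<forall>s\<in>K. continuous_map (top_of_set (closed_cell s)) Y f)"
proof -
  have eq: "{x \<in> topspace (realization K). f x \<in> U} \<inter> closed_cell s =
      {x \<in> closed_cell s. f x \<in> U}" if "s \<in> K" for U s
    using that by (auto simp: topspace_realization)
  have "f ` topspace (realization K) \<subseteq> topspace Y \<longleftrightarrow> (\<forall>s\<in>K. f ` closed_cell s \<subseteq> topspace Y)"
    unfolding topspace_realization by blast
  moreover have "openin (realization K) {x \<in> topspace (realization K). f x \<in> U} \<longleftrightarrow>
      (\<forall>s\<in>K. openin (top_of_set (closed_cell s)) {x \<in> closed_cell s. f x \<in> U})" for U
    unfolding openin_realization by (simp add: eq cong: ball_cong) (auto simp: topspace_realization)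
  ultimately show ?thesis
    unfolding continuous_map topspace_subtopology topspace_euclidean Int_UNIV_left by meson
qed

lemma continuous_map_cell_realization:
  "s \<in> K \<Longrightarrow> continuous_map (top_of_set (closed_cell s)) (realization K) id"
  using continuous_map_from_realization[THEN iffD1, OF continuous_map_id] by (rule bspec)

text \<open>A tube argument, based on compactness of the interval, shows that the product with a
  realization is governed by the prisms over the cells. Homotopies can thus be built prism by
  prism.\<close>

lemma continuous_map_prod_realization:
  assumes H: "\<And>s. s \<in> K \<Longrightarrow> continuous_map (top_of_set ({0..1::real} \<times> closed_cell s)) Y H"
  shows "continuous_map (prod_topology (top_of_set {0..1}) (realization K)) Y H"
  unfolding continuous_map
proof (intro conjI allI impI)
  show "H ` topspace (prod_topology (top_of_set {0..1}) (realization K)) \<subseteq> topspace Y"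
    using H by (fastforce simp: topspace_realization continuous_map)
  fix U assume U: "openin Y U"
  let ?W = "{p \<in> topspace (prod_topology (top_of_set {0..1}) (realization K)). H p \<in> U}"
  show "openin (prod_topology (top_of_set {0..1}) (realization K)) ?W"
    unfolding openin_prod_topology_alt
  proof (intro allI impI)
    fix t x assume tx: "(t, x) \<in> ?W"
    then obtain s where s: "s \<in> K" "x \<in> closed_cell s" and t: "t \<in> {0..1}" and Htx: "H (t,x) \<in> U"
      by (auto simp: topspace_realization)
    have "continuous_map (top_of_set {0..1}) (top_of_set ({0..1::real} \<times> closed_cell s)) (\<lambda>t. (t, x))"
      using s by (auto intro!: continuous_intros)
    then have "continuous_map (top_of_set {0..1}) Y (\<lambda>t. H (t, x))"
      using continuous_map_compose[OF _ H[OF s(1)]] unfolding o_def by blast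
    then have "openin (top_of_set {0..1}) {r \<in> {0..1}. H (r, x) \<in> U}"
      using openin_continuous_map_preimage[OF _ U, of "top_of_set {0..1}"] by simp
    then obtain e where e: "e > 0" "\<And>r. r \<in> {0..1} \<Longrightarrow> dist r t \<le> e \<Longrightarrow> H (r, x) \<in> U"
      using t Htx by (auto simp: openin_contains_cball subset_iff dist_commute)
    \<comment> \<open>The neighbourhood \<open>J\<close> of \<open>t\<close> is taken closed so that
      it is compact; \<open>B\<close> consists of the points whose whole slice over \<open>J\<close>
      is sent into \<open>U\<close>.\<close>
    define J where "J = cball t e \<inter> {0..1}"
    define B where "B = {y \<in> topspace (realization K). \<forall>r\<in>J. H (r, y) \<in> U}"
    have "openin (realization K) B"
      unfolding openin_realization
    proof (intro conjI ballI)
      show "B \<subseteq> (\<Union>s\<in>K. closed_cell s)" by (auto simp: B_def topspace_realization)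
      fix c assume c: "c \<in> K"
      let ?X = "prod_topology (top_of_set J) (top_of_set (closed_cell c))"
      have "compact J" by (auto simp: J_def)
      then have cl: "closed_map ?X (top_of_set (closed_cell c)) snd"
        by (intro closed_map_snd) (simp add: compact_space_subtopology)
      have "continuous_map ?X Y H"
        using continuous_map_from_subtopology_mono[OF H[OF c], of "J \<times> closed_cell c"]
        by (auto simp: J_def prod_topology_subtopology_eu)
      then have "closedin ?X {p \<in> topspace ?X. H p \<in> topspace Y - U}"
        using U by (intro closedin_continuous_map_preimage) auto
      then have cl2: "closedin (top_of_set (closed_cell c)) (snd ` {p \<in> topspace ?X. H p \<in> topspace Y - U})"
        using cl by (auto simp: closed_map_def)
      \<comment> \<open>The complement of \<open>B\<close> in a cell is the shadow of a relatively
        closed subset of the prism over \<open>J\<close>, and projection along a compact factor is a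
        closed map.\<close>
      have "B \<inter> closed_cell c = closed_cell c - snd ` {p \<in> topspace ?X. H p \<in> topspace Y - U}"
      proof -
        have "H p \<in> topspace Y" if "p \<in> J \<times> closed_cell c" for p
          using H[OF c] that unfolding continuous_map_def J_def by auto
        then have "{p \<in> topspace ?X. H p \<in> topspace Y - U} = {p \<in> J \<times> closed_cell c. H p \<notin> U}"
          by auto
        moreover have "closed_cell c \<subseteq> topspace (realization K)"
          using c by (auto simp: topspace_realization)
        ultimately show ?thesis
          unfolding B_def by (auto 0 3 simp: image_iff)
      qed
      with openin_diff[OF openin_subtopology_self cl2]
      show "openin (top_of_set (closed_cell c)) (B \<inter> closed_cell c)" by simp
    qed
    moreover have "openin (top_of_set {0..1}) (ball t e \<inter> {0..1})"
      by (metis Int_commute open_ball openin_open_Int)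
    moreover have "x \<in> B"
      using e s by (auto simp: B_def J_def topspace_realization dist_commute)
    moreover have "(ball t e \<inter> {0..1}) \<times> B \<subseteq> ?W"
      by (auto simp: B_def J_def)
    ultimately show "\<exists>A B. openin (top_of_set {0..1}) A \<and> openin (realization K) B \<and> t \<in> A \<and> x \<in> B \<and> A \<times> B \<subseteq> ?W"
      using e t by (intro exI[of _ "ball t e \<inter> {0..1}"] exI[of _ B]) auto
  qed
qed

lemma topspace_realization_mono: "L \<subseteq> K \<Longrightarrow> topspace (realization L) \<subseteq> topspace (realization K)"
  by (auto simp: topspace_realization)

text \<open>A simplex has only finitely many faces, so a closed subset of
  \<open>realization L\<close> meets every cell of \<open>K\<close> in a finite union of closed
  sets. This lets contractibility of a subcomplex be used inside the ambient realization.\<close>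

lemma subtopology_realization:
  assumes K: "abstract_simplicial_complex K" and L: "abstract_simplicial_complex L" and "L \<subseteq> K"
  shows "subtopology (realization K) (topspace (realization L)) = realization L"
  unfolding topology_eq
proof (intro allI iffI)
  fix U assume "openin (subtopology (realization K) (topspace (realization L))) U"
  then obtain V where V: "openin (realization K) V" "U = V \<inter> topspace (realization L)"
    by (auto simp: openin_subtopology)
  have "U \<inter> closed_cell s = V \<inter> closed_cell s" if "s \<in> L" for s
    using that V by (auto simp: topspace_realization)
  then show "openin (realization L) U"
    using V \<open>L \<subseteq> K\<close> by (auto simp: openin_realization topspace_realization)
next
  fix U assume U: "openin (realization L) U"
  define V where "V = topspace (realization K) - (topspace (realization L) - U)"
  have "openin (top_of_set (closed_cell t)) (V \<inter> closed_cell t)" if t: "t \<in> K" for t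
  proof -
    have ft: "finite t" using complexD[OF K t] by simp
    let ?F = "{s \<in> L. s \<subseteq> t}"
    have "finite ?F" using ft by auto
    moreover have "closedin (top_of_set (closed_cell t)) (closed_cell s - U)" if "s \<in> ?F" for s
    proof -
      have "closedin (top_of_set (closed_cell s)) (closed_cell s - U \<inter> closed_cell s)"
        using U that by (intro closedin_diff) (auto simp: openin_realization)
      moreover have "closed_cell s - U \<inter> closed_cell s = closed_cell s - U" by blast
      moreover have "closedin (top_of_set (closed_cell t)) (closed_cell s)"
        using closed_closed_cell closed_cell_mono[OF ft, of s] that
        by (auto intro!: closed_subset)
      ultimately show ?thesis by (metis closedin_trans)
    qed
    ultimately have cl: "closedin (top_of_set (closed_cell t)) (\<Union>s\<in>?F. closed_cell s - U)"
      by (intro closedin_Union) auto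
    have "V \<inter> closed_cell t = closed_cell t - (\<Union>s\<in>?F. closed_cell s - U)"
    proof -
      \<comment> \<open>The support of such a point is a simplex of \<open>L\<close> contained in
        \<open>t\<close>, hence one of the finitely many faces in \<open>?F\<close>.\<close>
      have "x \<in> (\<Union>s\<in>?F. closed_cell s - U)" 
        if "x \<in> topspace (realization L)" "x \<notin> U" "x \<in> closed_cell t" for x
        using supp_in_complex[OF L that(1)] that supp_subset[of x t] by blast
      then show ?thesis
        using t by (auto simp: V_def topspace_realization)
    qed
    with openin_diff[OF openin_subtopology_self cl] show ?thesis by simp
  qed
  then have "openin (realization K) V"
    unfolding openin_realization by (auto simp: V_def topspace_realization)
  moreover have "U = V \<inter> topspace (realization L)"
    using openin_subset[OF U] topspace_realization_mono[OF \<open>L \<subseteq> K\<close>] by (auto simp: V_def)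
  ultimately show "openin (subtopology (realization K) (topspace (realization L))) U"
    by (auto simp: openin_subtopology)
qed

lemma continuous_map_subcomplex:
  "L \<subseteq> K \<Longrightarrow> continuous_map (realization L) (realization K) id"
  unfolding continuous_map_from_realization using continuous_map_cell_realization by blast

subsection \<open>Acyclic carriers\<close>

lemma continuous_on_Max:
  fixes f :: "'v \<Rightarrow> 'a::topological_space \<Rightarrow> real"
  assumes "finite s" "s \<noteq> {}" "\<And>v. v \<in> s \<Longrightarrow> continuous_on S (f v)"
  shows "continuous_on S (\<lambda>x. Max ((\<lambda>v. f v x) ` s))"
  using assms
proof (induction rule: finite_ne_induct)
  case (insert v s)
  then show ?case
    by (simp add: continuous_on_max)
qed simp

text \<open>The boundary of the prism \<open>T \<times> closed_cell s\<close>. Taking \<open>T = {1/2}\<close> instead of \<open>{0..1}\<close>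
  removes the two ends, so that extending maps over cells and extending homotopies over cells become
  instances of one construction.\<close>

definition prism_boundary :: "real set \<Rightarrow> 'v set \<Rightarrow> (real \<times> ('v \<Rightarrow> real)) set"
  where "prism_boundary T s =
    {p \<in> T \<times> closed_cell s. fst p = 0 \<or> fst p = 1 \<or> (\<exists>v\<in>s. snd p v = 0)}"

text \<open>The Minkowski gauge of the prism about its centre, the point with \<open>t = 1/2\<close> and all
  barycentric coordinates equal; the projection to the boundary is radial from there.\<close>

definition prism_gauge :: "'v set \<Rightarrow> real \<times> ('v \<Rightarrow> real) \<Rightarrow> real"
  where "prism_gauge s p = max \<bar>2 * fst p - 1\<bar> (Max ((\<lambda>v. 1 - real (card s) * snd p v) ` s))"

definition prism_projection :: "'v set \<Rightarrow> real \<times> ('v \<Rightarrow> real) \<Rightarrow> real \<times> ('v \<Rightarrow> real)"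
  where "prism_projection s p =
    (1/2 + (fst p - 1/2) / prism_gauge s p,
     \<lambda>v. if v \<in> s then 1 / card s + (snd p v - 1 / card s) / prism_gauge s p else 0)"

lemma prism_gauge_ge:
  assumes "finite s"
  shows "\<bar>2 * fst p - 1\<bar> \<le> prism_gauge s p"
    and "v \<in> s \<Longrightarrow> 1 - real (card s) * snd p v \<le> prism_gauge s p"
proof -
  show "\<bar>2 * fst p - 1\<bar> \<le> prism_gauge s p"
    by (simp add: prism_gauge_def)
  show "1 - real (card s) * snd p v \<le> prism_gauge s p" if "v \<in> s"
    unfolding prism_gauge_def using assms that
    by (intro max.coboundedI2 Max_ge finite_imageI imageI)
qed

lemma prism_gauge_cases:
  assumes "finite s" "s \<noteq> {}"
  obtains "prism_gauge s p = \<bar>2 * fst p - 1\<bar>"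
    | v where "v \<in> s" "prism_gauge s p = 1 - real (card s) * snd p v"
proof -
  let ?m = "Max ((\<lambda>v. 1 - real (card s) * snd p v) ` s)"
  have "?m \<in> (\<lambda>v. 1 - real (card s) * snd p v) ` s"
    using assms by (intro Max_in) auto
  then obtain v where "v \<in> s" "?m = 1 - real (card s) * snd p v"
    by blast
  moreover have "prism_gauge s p = \<bar>2 * fst p - 1\<bar> \<or> prism_gauge s p = ?m"
    unfolding prism_gauge_def by linarith
  ultimately show ?thesis
    using that by metis
qed

lemma prism_gauge_le_1:
  assumes "finite s" "s \<noteq> {}" "p \<in> {0..1} \<times> closed_cell s"
  shows "prism_gauge s p \<le> 1"
proof (rule prism_gauge_cases[OF assms(1,2), of p])
  assume "prism_gauge s p = \<bar>2 * fst p - 1\<bar>"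
  then show ?thesis using assms(3) by auto
next
  fix v assume "v \<in> s" "prism_gauge s p = 1 - real (card s) * snd p v"
  moreover have "0 \<le> snd p v" using assms(3) by (auto simp: closed_cell_def)
  ultimately show ?thesis by simp
qed

lemma prism_gauge_boundary:
  assumes "finite s" "s \<noteq> {}" "T \<subseteq> {0..1}" "p \<in> prism_boundary T s"
  shows "prism_gauge s p = 1"
proof -
  have "prism_gauge s p \<le> 1"
    using assms by (intro prism_gauge_le_1) (auto simp: prism_boundary_def)
  moreover have "1 \<le> prism_gauge s p"
  proof (cases "fst p = 0 \<or> fst p = 1")
    case True
    then show ?thesis using prism_gauge_ge(1)[OF assms(1), of p] by auto
  next
    case False
    then obtain v where "v \<in> s" "snd p v = 0"
      using assms(4) by (auto simp: prism_boundary_def)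
    then show ?thesis using prism_gauge_ge(2)[OF assms(1), of v p] by simp
  qed
  ultimately show ?thesis by simp
qed

lemma continuous_on_prism_gauge:
  assumes "finite s" "s \<noteq> {}"
  shows "continuous_on S (prism_gauge s)"
proof -
  have c: "continuous_on S (\<lambda>p::real \<times> ('a \<Rightarrow> real). snd p v)" for v
    by (rule continuous_on_product_then_coordinatewise[OF continuous_on_snd[OF continuous_on_id]])
  show ?thesis
    unfolding prism_gauge_def
  proof (rule continuous_on_max)
    show "continuous_on S (\<lambda>p. Max ((\<lambda>v. 1 - real (card s) * snd p v) ` s))"
      by (rule continuous_on_Max[OF assms]) (intro continuous_on_diff continuous_on_mult continuous_on_const c)
  qed (intro continuous_intros)
qed

lemma continuous_on_prism_projection:
  assumes "finite s" "s \<noteq> {}" "\<And>p. p \<in> S \<Longrightarrow> prism_gauge s p \<noteq> 0"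
  shows "continuous_on S (prism_projection s)"
proof -
  have c: "continuous_on S (\<lambda>p::real \<times> ('a \<Rightarrow> real). snd p v)" for v
    by (rule continuous_on_product_then_coordinatewise[OF continuous_on_snd[OF continuous_on_id]])
  have "continuous_on S (\<lambda>p. if v \<in> s
      then 1 / real (card s) + (snd p v - 1 / real (card s)) / prism_gauge s p else 0)" for v
    using assms(3) by (cases "v \<in> s")
      (auto intro!: continuous_on_add continuous_on_divide continuous_on_diff continuous_on_const c
        continuous_on_prism_gauge[OF assms(1,2)])
  then show ?thesis
    unfolding prism_projection_def
    by (intro continuous_on_Pair continuous_on_coordinatewise_then_product)
       (use assms(3) in \<open>auto intro!: continuous_on_add continuous_on_divide continuous_on_diff
          continuous_on_const continuous_on_fst continuous_on_id continuous_on_prism_gauge[OF assms(1,2)]\<close>)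
qed

text \<open>Dividing by the gauge turns a constraint that attains the maximum into an equality and
  preserves the others, so the projected point stays in the prism and reaches a facet or an
  end.\<close>

lemma prism_projection_in_boundary:
  assumes T: "T = {1/2} \<or> T = {0..1}" and s: "finite s" "s \<noteq> {}"
    and p: "p \<in> T \<times> closed_cell s" and q: "0 < prism_gauge s p"
  shows "prism_projection s p \<in> prism_boundary T s"
proof -
  let ?q = "prism_gauge s p" and ?n = "real (card s)"
  have n: "?n > 0" using s by (simp add: card_gt_0_iff)
  have x: "snd p \<in> closed_cell s" using p by auto
  have coord: "1 / ?n + (snd p v - 1 / ?n) / ?q = (?q - (1 - ?n * snd p v)) / (?n * ?q)" for v
    using q n by (simp add: field_simps)
  have fst_eq: "1/2 + (fst p - 1/2) / ?q = (?q + (2 * fst p - 1)) / (2 * ?q)"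
    using q by (simp add: field_simps)
  have "fst (prism_projection s p) \<in> T"
    using T
  proof
    assume "T = {1/2}"
    then show ?thesis using p by (auto simp: prism_projection_def)
  next
    assume "T = {0..1}"
    moreover have "0 \<le> ?q + (2 * fst p - 1)" "?q + (2 * fst p - 1) \<le> 2 * ?q"
      using prism_gauge_ge(1)[OF s(1), of p] by auto
    ultimately show ?thesis using q by (simp add: prism_projection_def fst_eq)
  qed
  moreover have "snd (prism_projection s p) \<in> closed_cell s"
  proof -
    have "0 \<le> 1 / ?n + (snd p v - 1 / ?n) / ?q" if "v \<in> s" for v
      using prism_gauge_ge(2)[OF s(1) that, of p] q n unfolding coord by simp
    moreover have "(\<Sum>v\<in>s. 1 / ?n + (snd p v - 1 / ?n) / ?q) = 1"
      using x n by (simp add: sum.distrib sum_divide_distrib[symmetric] sum_subtractf closed_cell_def)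
    ultimately show ?thesis
      by (simp add: closed_cell_def prism_projection_def)
  qed
  moreover have "fst (prism_projection s p) = 0 \<or> fst (prism_projection s p) = 1 \<or>
      (\<exists>v\<in>s. snd (prism_projection s p) v = 0)"
  proof (rule prism_gauge_cases[OF s, of p])
    assume *: "?q = \<bar>2 * fst p - 1\<bar>"
    have "?q + (2 * fst p - 1) = 0 \<or> ?q + (2 * fst p - 1) = 2 * ?q"
      using * by linarith
    then show ?thesis using q by (auto simp: prism_projection_def fst_eq)
  next
    fix v assume v: "v \<in> s" "?q = 1 - ?n * snd p v"
    have "1 / ?n + (snd p v - 1 / ?n) / ?q = 0"
      unfolding coord using v(2) by simp
    with v(1) have "snd (prism_projection s p) v = 0"
      by (simp add: prism_projection_def)
    with v(1) show ?thesis by blast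
  qed
  ultimately show ?thesis
    by (simp add: prism_boundary_def mem_Times_iff)
qed

lemma prism_projection_boundary:
  assumes "finite s" "s \<noteq> {}" "T \<subseteq> {0..1}" "p \<in> prism_boundary T s"
  shows "prism_projection s p = p"
proof -
  have "snd p v = 0" if "v \<notin> s" for v
    using assms(4) that by (auto simp: prism_boundary_def closed_cell_def)
  then show ?thesis
    using prism_gauge_boundary[OF assms] by (auto simp: prism_projection_def prod_eq_iff)
qed

text \<open>A contraction of \<open>Y\<close> fills the boundary map: along each ray from the centre
  the outer half runs through the contraction, and the inner half is constant.\<close>

lemma extend_from_prism_boundary:
  assumes T: "T = {1/2} \<or> T = {0..1}" and s: "finite s" "s \<noteq> {}"
    and Y: "contractible_space Y" "topspace Y \<noteq> {}"
    and F: "continuous_map (top_of_set (prism_boundary T s)) Y F"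
  obtains E where "continuous_map (top_of_set (T \<times> closed_cell s)) Y E"
    "\<And>p. p \<in> prism_boundary T s \<Longrightarrow> E p = F p"
proof -
  have T01: "T \<subseteq> {0..1}" using T by auto
  obtain a k where k: "continuous_map (prod_topology (top_of_set {0..1::real}) Y) Y k"
      and k0: "\<And>y. k (0, y) = y" and k1: "\<And>y. k (1, y) = a"
    using Y(1) unfolding contractible_space_def homotopic_with_def by auto
  \<comment> \<open>Since \<open>Y\<close> is nonempty, the contraction ends at a point of
    \<open>Y\<close>. This supplies a value even where the boundary is empty, as over a single
    vertex with \<open>T = {1/2}\<close>.\<close>
  have a: "a \<in> topspace Y"
  proof -
    obtain y where y: "y \<in> topspace Y" using Y(2) by blast
    have "k (1, y) \<in> topspace Y"
      using y continuous_map_image_subset_topspace[OF k] by (auto simp: image_subset_iff)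
    then show ?thesis by (simp add: k1)
  qed
  let ?q = "prism_gauge s"
  let ?X = "T \<times> closed_cell s"
  \<comment> \<open>The contraction time is \<open>0\<close> on the boundary and \<open>1\<close> at
    gauge \<open>1/2\<close>, where both branches equal \<open>a\<close>. The cut at
    \<open>1/2\<close> stays clear of the centre, where the projection would divide by zero.\<close>
  define E where "E p = (if ?q p \<le> 1/2 then a else k (2 * (1 - ?q p), F (prism_projection s p)))" for p
  have "continuous_map (top_of_set ?X) Y E"
    unfolding E_def
  proof (rule continuous_map_cases_le)
    show "continuous_map (top_of_set ?X) euclideanreal ?q"
      using continuous_on_prism_gauge[OF s] by simp
    let ?Z = "{p \<in> topspace (top_of_set ?X). 1/2 \<le> ?q p}"
    have Z: "subtopology (top_of_set ?X) ?Z = top_of_set ?Z"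
      by (simp add: subtopology_subtopology Int_absorb1 Collect_conj_eq Int_assoc)
    have "continuous_map (top_of_set ?Z) (top_of_set {0..1}) (\<lambda>p. 2 * (1 - ?q p))"
      using prism_gauge_le_1[OF s] T01
      by (auto intro!: continuous_intros continuous_on_prism_gauge s)
    moreover have "continuous_map (top_of_set ?Z) (top_of_set (prism_boundary T s)) (prism_projection s)"
    proof -
      have "prism_projection s p \<in> prism_boundary T s" if "p \<in> ?Z" for p
        using that by (intro prism_projection_in_boundary[OF T s]) auto
      moreover have "continuous_on ?Z (prism_projection s)"
        by (rule continuous_on_prism_projection[OF s]) auto
      ultimately show ?thesis
        by (simp add: Pi_iff)
    qed
    then have "continuous_map (top_of_set ?Z) Y (F \<circ> prism_projection s)"
      using F by (rule continuous_map_compose)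
    ultimately have "continuous_map (top_of_set ?Z) (prod_topology (top_of_set {0..1}) Y)
        (\<lambda>p. (2 * (1 - ?q p), (F \<circ> prism_projection s) p))"
      by (rule continuous_map_pairedI)
    from continuous_map_compose[OF this k]
    show "continuous_map (subtopology (top_of_set ?X) ?Z) Y
        (\<lambda>p. k (2 * (1 - ?q p), F (prism_projection s p)))"
      unfolding Z by (simp add: o_def)
    show "a = k (2 * (1 - ?q p), F (prism_projection s p))" if "?q p = 1/2" for p
      by (simp add: that k1)
  qed (use a in auto)
  moreover have "E p = F p" if "p \<in> prism_boundary T s" for p
    using prism_gauge_boundary[OF s T01 that] prism_projection_boundary[OF s T01 that]
    by (simp add: E_def k0)
  ultimately show ?thesis using that by blast
qed

section \<open>Carriers in a topological space and extension over skeleta\<close>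

definition carrier :: "'v set set \<Rightarrow> 'b topology \<Rightarrow> ('v set \<Rightarrow> 'b set) \<Rightarrow> bool"
  where "carrier M Y C \<longleftrightarrow>
    (\<forall>s\<in>M. C s \<subseteq> topspace Y \<and> C s \<noteq> {} \<and> contractible_space (subtopology Y (C s))) \<and>
    (\<forall>s\<in>M. \<forall>t\<in>M. s \<subseteq> t \<longrightarrow> C s \<subseteq> C t)"

lemma carrierD:
  assumes "carrier M Y C" "s \<in> M"
  shows "C s \<subseteq> topspace Y" "C s \<noteq> {}" "contractible_space (subtopology Y (C s))"
    and "\<lbrakk>t \<in> M; t \<subseteq> s\<rbrakk> \<Longrightarrow> C t \<subseteq> C s"
  using assms by (simp_all add: carrier_def)

definition carried :: "'v set set \<Rightarrow> ('v set \<Rightarrow> 'b set) \<Rightarrow> (('v \<Rightarrow> real) \<Rightarrow> 'b) \<Rightarrow> bool"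
  where "carried M C f \<longleftrightarrow> (\<forall>s\<in>M. \<forall>x\<in>closed_cell s. f x \<in> C s)"

text \<open>The boundary is a finite union of closed pieces, namely the prisms over the facets of
  \<open>s\<close> and the ends that \<open>T\<close> contains, so continuity can be pasted.\<close>

lemma continuous_map_prism_boundary:
  assumes T: "closed T" and s: "finite s" "s \<noteq> {}"
    and faces: "\<And>v. v \<in> s \<Longrightarrow> continuous_map (top_of_set (T \<times> closed_cell (s - {v}))) Y F"
    and ends: "\<And>t. t \<in> T \<Longrightarrow> t = 0 \<or> t = 1 \<Longrightarrow> continuous_map (top_of_set (closed_cell s)) Y (\<lambda>x. F (t, x))"
  shows "continuous_map (top_of_set (prism_boundary T s)) Y F"
proof (rule pasting_lemma_closed)
  let ?I = "(\<lambda>v. T \<times> closed_cell (s - {v})) ` s \<union> (\<lambda>t. {t} \<times> closed_cell s) ` (T \<inter> {0, 1})"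
  show "finite ?I"
    using s by simp
  have sub: "closed A \<and> A \<subseteq> prism_boundary T s" if A: "A \<in> ?I" for A
  proof -
    have "T \<times> closed_cell (s - {v}) \<subseteq> prism_boundary T s" if "v \<in> s" for v
    proof -
      have "closed_cell (s - {v}) \<subseteq> closed_cell s"
        using s by (intro closed_cell_mono) auto
      moreover have "x v = 0" if "x \<in> closed_cell (s - {v})" for x
        using that by (simp add: closed_cell_def)
      ultimately show ?thesis
        using \<open>v \<in> s\<close> unfolding prism_boundary_def by fastforce
    qed
    moreover have "{t} \<times> closed_cell s \<subseteq> prism_boundary T s" if "t \<in> T \<inter> {0, 1}" for t
      using that by (auto simp: prism_boundary_def)
    moreover have "closed A"
      using A T by (auto intro!: closed_Times closed_closed_cell)
    ultimately show ?thesis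
      using A by blast
  qed
  show "closedin (top_of_set (prism_boundary T s)) A" if "A \<in> ?I" for A
    using sub[OF that] by (simp add: closed_subset)
  show "continuous_map (subtopology (top_of_set (prism_boundary T s)) A) Y F" if A: "A \<in> ?I" for A
  proof -
    have "continuous_map (top_of_set A) Y F"
    proof (cases "A \<in> (\<lambda>v. T \<times> closed_cell (s - {v})) ` s")
      case True
      then show ?thesis using faces by blast
    next
      case False
      then obtain t where t: "t \<in> T" "t = 0 \<or> t = 1" and At: "A = {t} \<times> closed_cell s"
        using A by blast
      have "continuous_map (top_of_set A) (top_of_set (closed_cell s)) snd"
        unfolding At using continuous_on_snd[OF continuous_on_id] by auto
      from continuous_map_compose[OF this ends[OF t]] show ?thesis
        by (rule continuous_map_eq) (auto simp: At)
    qed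
    moreover have "subtopology (top_of_set (prism_boundary T s)) A = top_of_set A"
      using sub[OF A] by (simp add: subtopology_subtopology Int_absorb1)
    ultimately show ?thesis by simp
  qed
  show "\<exists>A. A \<in> ?I \<and> p \<in> A \<and> F p = F p" if p: "p \<in> topspace (top_of_set (prism_boundary T s))" for p
  proof -
    obtain t x where p_eq: "p = (t, x)" by fastforce
    have tx: "p = (t, x)" "t \<in> T" "x \<in> closed_cell s"
      and *: "t = 0 \<or> t = 1 \<or> (\<exists>v\<in>s. x v = 0)"
      using p unfolding prism_boundary_def p_eq by simp_all
    show ?thesis
    proof (cases "t = 0 \<or> t = 1")
      case True
      then have "{t} \<times> closed_cell s \<in> ?I" using tx by blast
      then show ?thesis using tx by blast
    next
      case False
      then obtain v where v: "v \<in> s" "x v = 0" using * by blast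
      then have "supp x \<subseteq> s - {v}"
        using supp_subset[OF tx(3)] by (auto simp: supp_def)
      then have "x \<in> closed_cell (s - {v})"
        using closed_cell_iff_supp[OF s(1) tx(3)] s by simp
      then show ?thesis using tx v by blast
    qed
  qed
qed simp

text \<open>Monotonicity of the carrier puts the values already given on the boundary of a prism
  into \<open>C s\<close>, and contractibility of \<open>C s\<close> fills the prism. With
  \<open>T = {1/2}\<close> no ends are prescribed; with \<open>T = {0..1}\<close> the ends are the
  two maps to be joined.\<close>

lemma carried_extension:
  fixes h :: "real \<times> ('v \<Rightarrow> real) \<Rightarrow> 'b"
  assumes M: "abstract_simplicial_complex M" and C: "carrier M Y C"
    and T: "T = {1/2} \<or> T = {0..1}"
    and h: "\<And>t s. t \<in> T \<Longrightarrow> t = 0 \<or> t = 1 \<Longrightarrow> s \<in> M \<Longrightarrow>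
      continuous_map (top_of_set (closed_cell s)) (subtopology Y (C s)) (\<lambda>x. h (t, x))"
  obtains H where "\<And>s. s \<in> M \<Longrightarrow>
      continuous_map (top_of_set (T \<times> closed_cell s)) (subtopology Y (C s)) H"
    and "\<And>t x. t \<in> T \<Longrightarrow> t = 0 \<or> t = 1 \<Longrightarrow> x \<in> topspace (realization M) \<Longrightarrow> H (t, x) = h (t, x)"
proof -
  \<comment> \<open>Carried continuity is asked only over simplices with at most \<open>n\<close>
    vertices, but the end values are fixed over all of \<open>M\<close>, so that new simplices find
    their ends already in place.\<close>
  define good where "good n F \<longleftrightarrow>
    (\<forall>s\<in>M. card s \<le> n \<longrightarrow> continuous_map (top_of_set (T \<times> closed_cell s)) (subtopology Y (C s)) F) \<and>
    (\<forall>t\<in>T. \<forall>x\<in>topspace (realization M). t = 0 \<or> t = 1 \<longrightarrow> F (t, x) = h (t, x))" for n F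
  define agree where "agree n F G \<longleftrightarrow>
    (\<forall>s\<in>M. card s \<le> n \<longrightarrow> (\<forall>t\<in>T. \<forall>x\<in>closed_cell s. G (t, x) = F (t, x)))"
    for n :: nat and F G :: "real \<times> ('v \<Rightarrow> real) \<Rightarrow> 'b"
  have "closed T"
    using T by auto
  have cell: "x \<in> topspace (realization M)" if "s \<in> M" "x \<in> closed_cell s" for s x
    using that by (auto simp: topspace_realization)
  \<comment> \<open>A map on the cells with at most \<open>n\<close> vertices extends, cell by cell, to those with \<open>Suc n\<close>.\<close>
  have step: "\<exists>G. good (Suc n) G \<and> agree n F G" if F: "good n F" for n F
  proof -
    have "\<exists>E. continuous_map (top_of_set (T \<times> closed_cell s)) (subtopology Y (C s)) E \<and>
        (\<forall>p\<in>prism_boundary T s. E p = F p)" if s: "s \<in> M" "card s = Suc n" for s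
    proof -
      note fin = complexD(1,2)[OF M s(1)]
      have "continuous_map (top_of_set (prism_boundary T s)) (subtopology Y (C s)) F"
      proof (rule continuous_map_prism_boundary[OF \<open>closed T\<close> fin])
        fix v assume v: "v \<in> s"
        show "continuous_map (top_of_set (T \<times> closed_cell (s - {v}))) (subtopology Y (C s)) F"
        proof (cases "s - {v} = {}")
          case True
          show ?thesis unfolding True by (simp add: continuous_map_def)
        next
          case False
          then have sv: "s - {v} \<in> M"
            by (rule complexD(3)[OF M s(1) Diff_subset])
          moreover have "card (s - {v}) \<le> n"
            using s v fin by simp
          ultimately have "continuous_map (top_of_set (T \<times> closed_cell (s - {v}))) (subtopology Y (C (s - {v}))) F"
            using F by (simp add: good_def)
          then show ?thesis
            using carrierD(4)[OF C s(1) sv] by (auto simp: continuous_map_in_subtopology)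
        qed
      next
        fix t assume t: "t \<in> T" "t = 0 \<or> t = 1"
        show "continuous_map (top_of_set (closed_cell s)) (subtopology Y (C s)) (\<lambda>x. F (t, x))"
          by (rule continuous_map_eq[OF h[OF t s(1)]]) (use F t cell[OF s(1)] in \<open>auto simp: good_def\<close>)
      qed
      then show ?thesis
        using extend_from_prism_boundary[OF T fin carrierD(3)[OF C s(1)]] carrierD(1,2)[OF C s(1)]
        by (metis topspace_subtopology_subset)
    qed
    then obtain E where
        E: "\<And>s. s \<in> M \<Longrightarrow> card s = Suc n \<Longrightarrow>
            continuous_map (top_of_set (T \<times> closed_cell s)) (subtopology Y (C s)) (E s)"
      and EF: "\<And>s p. s \<in> M \<Longrightarrow> card s = Suc n \<Longrightarrow> p \<in> prism_boundary T s \<Longrightarrow> E s p = F p"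
      by metis
    define G where "G p = (if supp (snd p) \<in> M \<and> card (supp (snd p)) = Suc n
      then E (supp (snd p)) p else F p)" for p
    have GF: "G (t, x) = F (t, x)" if "s \<in> M" "card s \<le> n" "x \<in> closed_cell s" for t x s
    proof -
      have "card (supp x) \<le> n"
        using card_mono[OF complexD(1)[OF M that(1)] supp_subset[OF that(3)]] that(2) by simp
      then show ?thesis by (simp add: G_def)
    qed
    \<comment> \<open>A point of the cell with smaller support lies on the prism boundary, where
      \<open>E s\<close> extends \<open>F\<close>; hence choosing the extension by support gives
      \<open>E s\<close> on the whole prism.\<close>
    have GE: "G (t, x) = E s (t, x)" if s: "s \<in> M" "card s = Suc n" and tx: "t \<in> T" "x \<in> closed_cell s" for s t x
    proof (cases "supp x = s")
      case True
      then show ?thesis using s by (simp add: G_def)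
    next
      case False
      then have "supp x \<subset> s" using supp_subset[OF tx(2)] by blast
      moreover from this have "card (supp x) < card s"
        by (rule psubset_card_mono[OF complexD(1)[OF M s(1)]])
      ultimately have "G (t, x) = F (t, x)" "\<exists>v\<in>s. x v = 0"
        using s by (auto simp: G_def supp_def)
      moreover from this have "(t, x) \<in> prism_boundary T s"
        using tx by (simp add: prism_boundary_def)
      ultimately show ?thesis
        using EF[OF s] by simp
    qed
    have "continuous_map (top_of_set (T \<times> closed_cell s)) (subtopology Y (C s)) G"
      if s: "s \<in> M" "card s \<le> Suc n" for s
    proof (cases "card s = Suc n")
      case True
      show ?thesis
        by (rule continuous_map_eq[OF E[OF s(1) True]]) (use GE[OF s(1) True] in auto)
    next
      case False
      then have "card s \<le> n" using s by simp
      with F s(1) have "continuous_map (top_of_set (T \<times> closed_cell s)) (subtopology Y (C s)) F"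
        by (simp add: good_def)
      then show ?thesis
        by (rule continuous_map_eq) (use GF[OF s(1) \<open>card s \<le> n\<close>] in auto)
    qed
    moreover have "G (t, x) = h (t, x)"
      if t: "t \<in> T" "t = 0 \<or> t = 1" and x: "x \<in> topspace (realization M)" for t x
    proof -
      have "(t, x) \<in> prism_boundary T (supp x)"
        using t supp_in_complex(2)[OF M x] by (auto simp: prism_boundary_def)
      then have "G (t, x) = F (t, x)"
        using EF[of "supp x"] by (simp add: G_def)
      then show ?thesis
        using F t x unfolding good_def by metis
    qed
    ultimately have "good (Suc n) G"
      by (simp add: good_def)
    moreover have "agree n F G"
      using GF by (simp add: agree_def)
    ultimately show ?thesis by blast
  qed
  \<comment> \<open>No simplex has \<open>0\<close> vertices, so the prescribed function itself
    starts the construction.\<close>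
  have "good 0 h"
    using complexD(1,2)[OF M] by (auto simp: good_def)
  then have "\<exists>F. \<forall>n. good n (F n) \<and> agree n (F n) (F (Suc n))"
    by (intro dependent_nat_choice step) blast
  then obtain F where F: "\<And>n. good n (F n)" and FS: "\<And>n. agree n (F n) (F (Suc n))"
    by blast
  \<comment> \<open>The stages stabilise on each prism, and the number of vertices in the support
    selects a stage that is already final; this also covers unbounded dimension.\<close>
  define H where "H p = F (card (supp (snd p))) p" for p
  have stable: "F m (t, x) = F k (t, x)"
    if "k \<le> m" "s \<in> M" "card s \<le> k" "x \<in> closed_cell s" "t \<in> T" for k m s x t
    using that(1)
  proof (induction rule: dec_induct)
    case (step m)
    have "card s \<le> m" using step that by simp
    then show ?case
      using FS[of m] step that by (simp add: agree_def)
  qed simp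
  show ?thesis
  proof (rule that[of H])
    fix s assume s: "s \<in> M"
    have HF: "F (card s) (t, x) = H (t, x)" if "t \<in> T" "x \<in> closed_cell s" for t x
    proof -
      note x = supp_in_complex[OF M cell[OF s that(2)]]
      have "card (supp x) \<le> card s"
        using card_mono[OF complexD(1)[OF M s] supp_subset[OF that(2)]] .
      then show ?thesis
        unfolding H_def snd_conv by (rule stable[OF _ x(1) order_refl x(2) that(1)])
    qed
    have "continuous_map (top_of_set (T \<times> closed_cell s)) (subtopology Y (C s)) (F (card s))"
      using F[of "card s"] s by (simp add: good_def)
    then show "continuous_map (top_of_set (T \<times> closed_cell s)) (subtopology Y (C s)) H"
      by (rule continuous_map_eq) (use HF in auto)
  next
    fix t x assume "t \<in> T" "t = 0 \<or> t = 1" "x \<in> topspace (realization M)"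
    then show "H (t, x) = h (t, x)"
      using F unfolding H_def good_def by metis
  qed
qed

lemma carried_map_exists:
  assumes M: "abstract_simplicial_complex M" and C: "carrier M Y C"
  obtains f where "continuous_map (realization M) Y f" "carried M C f"
proof -
  \<comment> \<open>The slice \<open>{1/2}\<close> contains neither end, so the conditions on the
    prescribed values are vacuous.\<close>
  obtain H where H: "\<And>s. s \<in> M \<Longrightarrow>
      continuous_map (top_of_set ({1/2::real} \<times> closed_cell s)) (subtopology Y (C s)) H"
    by (rule carried_extension[OF M C, of "{1/2}"]) auto
  have *: "continuous_map (top_of_set (closed_cell s)) (subtopology Y (C s)) (\<lambda>x. H (1/2, x))"
    if s: "s \<in> M" for s
  proof -
    have "continuous_map (top_of_set (closed_cell s)) (top_of_set ({1/2::real} \<times> closed_cell s)) (\<lambda>x. (1/2, x))"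
      by (auto intro!: continuous_intros)
    from continuous_map_compose[OF this H[OF s]] show ?thesis
      by (simp add: o_def)
  qed
  show ?thesis
  proof (rule that[of "\<lambda>x. H (1/2, x)"])
    show "continuous_map (realization M) Y (\<lambda>x. H (1/2, x))"
      using * by (simp add: continuous_map_from_realization continuous_map_in_subtopology)
    show "carried M C (\<lambda>x. H (1/2, x))"
      using * by (auto simp: carried_def continuous_map_in_subtopology)
  qed
qed

lemma carried_imp_homotopic:
  assumes M: "abstract_simplicial_complex M" and C: "carrier M Y C"
    and f: "continuous_map (realization M) Y f" "carried M C f"
    and g: "continuous_map (realization M) Y g" "carried M C g"
  shows "homotopic_with (\<lambda>_. True) (realization M) Y f g"
proof -
  have fg: "continuous_map (top_of_set (closed_cell s)) (subtopology Y (C s)) k"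
    if "continuous_map (realization M) Y k" "carried M C k" "s \<in> M" for k s
    using that by (auto simp: continuous_map_from_realization continuous_map_in_subtopology carried_def)
  \<comment> \<open>Only the values at \<open>t = 0\<close> and \<open>t = 1\<close> count; between
    them \<open>g x\<close> is a filler.\<close>
  let ?h = "\<lambda>(t::real, x). if t = 0 then f x else g x"
  obtain H where H: "\<And>s. s \<in> M \<Longrightarrow>
      continuous_map (top_of_set ({0..1::real} \<times> closed_cell s)) (subtopology Y (C s)) H"
    and Hh: "\<And>t x. t \<in> {0..1} \<Longrightarrow> t = 0 \<or> t = 1 \<Longrightarrow> x \<in> topspace (realization M) \<Longrightarrow> H (t, x) = ?h (t, x)"
  proof (rule carried_extension[OF M C, of "{0..1}" ?h])
    fix t :: real and s assume "t = 0 \<or> t = 1" "s \<in> M"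
    then show "continuous_map (top_of_set (closed_cell s)) (subtopology Y (C s)) (\<lambda>x. ?h (t, x))"
      using fg[OF f] fg[OF g] by auto
  qed auto
  have "continuous_map (prod_topology (top_of_set {0..1}) (realization M)) Y H"
    using H by (intro continuous_map_prod_realization) (auto simp: continuous_map_in_subtopology)
  moreover have "H (0, x) = f x" "H (1, x) = g x" if "x \<in> topspace (realization M)" for x
    using Hh[of 0 x] Hh[of 1 x] that by auto
  ultimately show ?thesis
    by (subst homotopic_with) auto
qed

subsection \<open>Polyhedra and barycentric subdivision\<close>

abbreviation polyhedron :: "'v set set \<Rightarrow> ('v \<Rightarrow> real) set"
  where "polyhedron K \<equiv> topspace (realization K)"

lemma closed_cell_in_polyhedron: "s \<in> K \<Longrightarrow> x \<in> closed_cell s \<Longrightarrow> x \<in> polyhedron K"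
  by (auto simp: topspace_realization)

lemma polyhedron_nonempty:
  assumes "abstract_simplicial_complex K" "K \<noteq> {}"
  shows "polyhedron K \<noteq> {}"
proof -
  obtain s where s: "s \<in> K" using assms(2) by blast
  note fin = complexD(1,2)[OF assms(1) s]
  then obtain v where "v \<in> s" by blast
  then have "(\<lambda>w. if w = v then 1 else 0) \<in> closed_cell s"
    using fin by (simp add: closed_cell_def)
  then show ?thesis
    using closed_cell_in_polyhedron[OF s] by blast
qed

text \<open>The straight-line homotopy to the vertex \<open>v\<close> runs inside the cell of
  \<open>insert v s\<close>, and its continuity is checked on prisms.\<close>

lemma contractible_cone:
  assumes cone: "\<And>s. s \<in> K \<Longrightarrow> insert v s \<in> K" and fin: "\<And>s. s \<in> K \<Longrightarrow> finite s"
  shows "contractible_complex K"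
proof -
  let ?e = "\<lambda>w. if w = v then 1 else (0::real)"
  let ?H = "\<lambda>p w. (1 - fst p) * snd p w + fst p * ?e w"
  have "continuous_map (top_of_set ({0..1} \<times> closed_cell s)) (realization K) ?H" if s: "s \<in> K" for s
  proof -
    have "?H p \<in> closed_cell (insert v s)" if p: "p \<in> {0..1} \<times> closed_cell s" for p
    proof -
      have "snd p \<in> closed_cell (insert v s)"
        using p closed_cell_mono[OF _ subset_insertI[of s v]] fin[OF s] by auto
      moreover have "(\<Sum>w\<in>insert v s. ?e w) = 1"
        using fin[OF s] by simp
      ultimately show ?thesis
        using p by (auto simp: closed_cell_def sum.distrib sum_distrib_left[symmetric] simp del: sum.insert)
    qed
    moreover have "continuous_on ({0..1} \<times> closed_cell s) ?H"
      by (intro continuous_on_coordinatewise_then_product continuous_on_add continuous_on_mult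
          continuous_on_diff continuous_on_const continuous_on_fst continuous_on_id
          continuous_on_product_then_coordinatewise[OF continuous_on_snd[OF continuous_on_id]])
    ultimately have "continuous_map (top_of_set ({0..1} \<times> closed_cell s)) (top_of_set (closed_cell (insert v s))) ?H"
      by (simp add: Pi_iff)
    from continuous_map_compose[OF this continuous_map_cell_realization[OF cone[OF s]]]
    show ?thesis by simp
  qed
  then have "continuous_map (prod_topology (top_of_set {0..1}) (realization K)) (realization K) ?H"
    by (rule continuous_map_prod_realization)
  then show ?thesis
    unfolding contractible_complex_def contractible_space_def homotopic_with_def
    by (intro exI[of _ ?e] exI[of _ ?H]) auto
qed

text \<open>The sum defining \<open>realization_map\<close> ranges over the support, which varies
  with the point. On a cell it can be taken over the fixed set \<open>s\<close>, which makes
  continuity visible.\<close>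

lemma realization_map_in_cell:
  assumes "finite s" "x \<in> closed_cell s"
  shows "realization_map f x \<in> closed_cell (f ` s)"
    and "realization_map f x = (\<lambda>w. \<Sum>v\<in>s. if f v = w then x v else 0)"
proof -
  have *: "realization_map f x w = (\<Sum>v\<in>s. if f v = w then x v else 0)" for w
    unfolding realization_map_def
    using assms supp_subset[OF assms(2)]
    by (intro sum.mono_neutral_cong_left) (auto simp: supp_def)
  then show "realization_map f x = (\<lambda>w. \<Sum>v\<in>s. if f v = w then x v else 0)"
    by blast
  have "(\<Sum>w\<in>f ` s. \<Sum>v\<in>s. if f v = w then x v else 0) = (\<Sum>v\<in>s. \<Sum>w\<in>f ` s. if f v = w then x v else 0)"
    by (rule sum.swap)
  also have "\<dots> = sum x s"
    using assms(1) by (intro sum.cong) auto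
  finally show "realization_map f x \<in> closed_cell (f ` s)"
    using assms(2) by (auto simp: closed_cell_def * intro!: sum_nonneg sum.neutral)
qed

lemma continuous_map_realization_map:
  assumes K: "abstract_simplicial_complex K" and f: "\<And>s. s \<in> K \<Longrightarrow> f ` s \<in> L"
  shows "continuous_map (realization K) (realization L) (realization_map f)"
  unfolding continuous_map_from_realization
proof
  fix s assume s: "s \<in> K"
  note fin = complexD(1)[OF K s]
  have "continuous_on (closed_cell s) (\<lambda>x w. \<Sum>v\<in>s. if f v = w then x v else (0::real))"
  proof (intro continuous_on_coordinatewise_then_product continuous_on_sum)
    show "continuous_on (closed_cell s) (\<lambda>x. if f v = w then x v else 0)" for v w
      by (cases "f v = w") (auto intro: continuous_on_product_coordinates continuous_on_subset)
  qed
  then have "continuous_on (closed_cell s) (realization_map f)"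
    by (rule continuous_on_eq) (simp add: realization_map_in_cell(2)[OF fin])
  then have "continuous_map (top_of_set (closed_cell s)) (top_of_set (closed_cell (f ` s))) (realization_map f)"
    using realization_map_in_cell(1)[OF fin] by auto
  from continuous_map_compose[OF this continuous_map_cell_realization[OF f[OF s]]]
  show "continuous_map (top_of_set (closed_cell s)) (realization L) (realization_map f)"
    by simp
qed

section \<open>Carriers with values in subcomplexes\<close>

definition acyclic_carrier :: "'v set set \<Rightarrow> 'w set set \<Rightarrow> ('v set \<Rightarrow> 'w set set) \<Rightarrow> bool"
  where "acyclic_carrier M L \<Phi> \<longleftrightarrow>
    (\<forall>s\<in>M. subcomplex (\<Phi> s) L \<and> \<Phi> s \<noteq> {} \<and> contractible_complex (\<Phi> s)) \<and>
    (\<forall>s\<in>M. \<forall>t\<in>M. s \<subseteq> t \<longrightarrow> \<Phi> s \<subseteq> \<Phi> t)"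

text \<open>The values of an \<open>acyclic_carrier\<close> are contractible, not merely acyclic in
  homology, and contractibility in their own weak topology transfers because it agrees with the
  subspace topology.\<close>

lemma carrier_polyhedron:
  assumes L: "abstract_simplicial_complex L" and \<Phi>: "acyclic_carrier M L \<Phi>"
  shows "carrier M (realization L) (\<lambda>s. polyhedron (\<Phi> s))"
proof -
  have "polyhedron (\<Phi> s) \<subseteq> polyhedron L \<and> polyhedron (\<Phi> s) \<noteq> {} \<and>
      contractible_space (subtopology (realization L) (polyhedron (\<Phi> s)))" if "s \<in> M" for s
  proof -
    have sub: "abstract_simplicial_complex (\<Phi> s)" "\<Phi> s \<subseteq> L" "\<Phi> s \<noteq> {}" "contractible_complex (\<Phi> s)"
      using \<Phi> that by (simp_all add: acyclic_carrier_def subcomplex_def)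
    then show ?thesis
      using subtopology_realization[OF L sub(1,2)] topspace_realization_mono[OF sub(2)]
        polyhedron_nonempty[OF sub(1,3)] by (simp add: contractible_complex_def)
  qed
  moreover have "polyhedron (\<Phi> s) \<subseteq> polyhedron (\<Phi> t)" if "s \<in> M" "t \<in> M" "s \<subseteq> t" for s t
    using \<Phi> that by (intro topspace_realization_mono) (simp add: acyclic_carrier_def)
  ultimately show ?thesis
    by (simp add: carrier_def)
qed

definition map_carried :: "'v set set \<Rightarrow> 'w set set \<Rightarrow> ('v set \<Rightarrow> 'w set set) \<Rightarrow>
    (('v \<Rightarrow> real) \<Rightarrow> ('w \<Rightarrow> real)) \<Rightarrow> bool"
  where "map_carried M L \<Phi> f \<longleftrightarrow> continuous_map (realization M) (realization L) f \<and>
    carried M (\<lambda>s. polyhedron (\<Phi> s)) f"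

lemma map_carried_exists:
  assumes "abstract_simplicial_complex M" "abstract_simplicial_complex L" "acyclic_carrier M L \<Phi>"
  obtains f where "map_carried M L \<Phi> f"
  using carried_map_exists[OF assms(1) carrier_polyhedron[OF assms(2,3)]]
  unfolding map_carried_def by blast

lemma map_carried_imp_homotopic:
  assumes "abstract_simplicial_complex M" "abstract_simplicial_complex L" "acyclic_carrier M L \<Phi>"
    and "map_carried M L \<Phi> f" "map_carried M L \<Phi> g"
  shows "homotopic_with (\<lambda>_. True) (realization M) (realization L) f g"
  using carried_imp_homotopic[OF assms(1) carrier_polyhedron[OF assms(2,3)]] assms(4,5)
  unfolding map_carried_def by blast

lemma map_carried_continuous: "map_carried M L \<Phi> f \<Longrightarrow> continuous_map (realization M) (realization L) f"
  by (simp add: map_carried_def)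

lemma map_carried_polyhedron:
  assumes "map_carried M L \<Phi> f" "x \<in> polyhedron P" "\<And>s. s \<in> P \<Longrightarrow> s \<in> M \<and> \<Phi> s \<subseteq> Q"
  shows "f x \<in> polyhedron Q"
proof -
  obtain s where s: "s \<in> P" "x \<in> closed_cell s"
    using assms(2) by (auto simp: topspace_realization)
  with assms have "f x \<in> polyhedron (\<Phi> s)"
    by (auto simp: map_carried_def carried_def)
  then show ?thesis
    using topspace_realization_mono[of "\<Phi> s" Q] assms(3)[OF s(1)] by blast
qed

lemma map_carriedI:
  assumes "continuous_map (realization M) (realization L) f"
    and "\<And>s x. s \<in> M \<Longrightarrow> x \<in> closed_cell s \<Longrightarrow> f x \<in> polyhedron (\<Phi> s)"
  shows "map_carried M L \<Phi> f"
  using assms by (simp add: map_carried_def carried_def)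

section \<open>Full simplices and barycentric subdivision\<close>

definition faces :: "'v set \<Rightarrow> 'v set set"
  where "faces s = {t. t \<subseteq> s \<and> t \<noteq> {}}"

lemma complex_faces: "finite s \<Longrightarrow> abstract_simplicial_complex (faces s)"
  by (auto simp: abstract_simplicial_complex_def faces_def intro: finite_subset)

lemma faces_mono: "s \<subseteq> t \<Longrightarrow> faces s \<subseteq> faces t"
  by (auto simp: faces_def)

lemma faces_subset:
  assumes "abstract_simplicial_complex K" "s \<in> K"
  shows "faces s \<subseteq> K"
  using complexD(3)[OF assms] by (auto simp: faces_def)

lemma self_in_faces: "s \<noteq> {} \<Longrightarrow> s \<in> faces s"
  by (simp add: faces_def)

lemma contractible_faces:
  assumes "finite s" "s \<noteq> {}"
  shows "contractible_complex (faces s)"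
proof -
  obtain v where "v \<in> s" using assms(2) by blast
  then show ?thesis
    by (intro contractible_cone[of _ v]) (use assms(1) in \<open>auto simp: faces_def intro: finite_subset\<close>)
qed

text \<open>Barycentric subdivision: its vertices are the simplices of \<open>K\<close>. For a simplex \<open>c\<close> of \<open>sd K\<close>,
  that is, a finite chain, \<open>\<Inter>c\<close> and \<open>\<Union>c\<close> are its least and its greatest member.\<close>

definition sd :: "'v set set \<Rightarrow> 'v set set set"
  where "sd K = {c. finite c \<and> c \<noteq> {} \<and> c \<subseteq> K \<and> (\<forall>a\<in>c. \<forall>b\<in>c. a \<subseteq> b \<or> b \<subseteq> a)}"

lemma complex_sd: "abstract_simplicial_complex (sd K)"
  unfolding abstract_simplicial_complex_def sd_def
  by (auto intro: finite_subset dest: subsetD)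

lemma sd_mono: "K \<subseteq> L \<Longrightarrow> sd K \<subseteq> sd L"
  by (auto simp: sd_def)

text \<open>A set \<open>v\<close> comparable with every element can be inserted into every chain,
  which makes the order complex a cone. This applies to any family of sets, for example an up-set of
  simplices.\<close>

lemma contractible_sd:
  assumes "v \<in> K" "\<And>s. s \<in> K \<Longrightarrow> s \<subseteq> v \<or> v \<subseteq> s"
  shows "contractible_complex (sd K)"
  by (rule contractible_cone[of _ v]) (use assms in \<open>auto simp: sd_def\<close>)

lemma singleton_in_sd: "s \<in> K \<Longrightarrow> {s} \<in> sd K"
  by (simp add: sd_def)

lemma sd_Union_Inter:
  assumes "c \<in> sd K"
  shows "\<Union>c \<in> c" "\<Inter>c \<in> c"
proof -
  have "finite c" "c \<noteq> {}" "\<forall>a\<in>c. \<forall>b\<in>c. a \<subseteq> b \<or> b \<subseteq> a"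
    using assms by (simp_all add: sd_def)
  then have "\<Union>c \<in> c \<and> \<Inter>c \<in> c"
  proof (induction rule: finite_ne_induct)
    case (insert a c)
    then have IH: "\<Union>c \<in> c" "\<Inter>c \<in> c" by auto
    then have "a \<subseteq> \<Union>c \<or> \<Union>c \<subseteq> a" "a \<subseteq> \<Inter>c \<or> \<Inter>c \<subseteq> a"
      using insert.prems by blast+
    then have "a \<union> \<Union>c = a \<or> a \<union> \<Union>c = \<Union>c" "a \<inter> \<Inter>c = a \<or> a \<inter> \<Inter>c = \<Inter>c"
      by blast+
    with IH show ?case by auto
  qed simp
  then show "\<Union>c \<in> c" "\<Inter>c \<in> c" by auto
qed

lemma sd_Union_Inter_in: "c \<in> sd K \<Longrightarrow> \<Union>c \<in> K" "c \<in> sd K \<Longrightarrow> \<Inter>c \<in> K"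
  using sd_Union_Inter[of c K] by (auto simp: sd_def)

text \<open>The subdivision of a full simplex is a cone whose apex is the simplex itself, viewed as
  its barycentre.\<close>

lemma acyclic_carrier_sd_faces:
  assumes K: "abstract_simplicial_complex K"
    and \<phi>: "\<And>s. s \<in> M \<Longrightarrow> \<phi> s \<in> K" "\<And>s t. s \<in> M \<Longrightarrow> t \<in> M \<Longrightarrow> s \<subseteq> t \<Longrightarrow> \<phi> s \<subseteq> \<phi> t"
  shows "acyclic_carrier M (sd K) (\<lambda>s. sd (faces (\<phi> s)))"
  unfolding acyclic_carrier_def subcomplex_def
proof (intro conjI ballI impI complex_sd)
  fix s assume s: "s \<in> M"
  note self = self_in_faces[OF complexD(2)[OF K \<phi>(1)[OF s]]]
  show "sd (faces (\<phi> s)) \<subseteq> sd K"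
    by (intro sd_mono faces_subset K \<phi> s)
  show "sd (faces (\<phi> s)) \<noteq> {}"
    using singleton_in_sd[OF self] by blast
  show "contractible_complex (sd (faces (\<phi> s)))"
    by (rule contractible_sd[OF self]) (simp add: faces_def)
next
  fix s t assume "s \<in> M" "t \<in> M" "s \<subseteq> t"
  then show "sd (faces (\<phi> s)) \<subseteq> sd (faces (\<phi> t))"
    by (intro sd_mono faces_mono \<phi>)
qed

lemma acyclic_carrier_faces:
  assumes K: "abstract_simplicial_complex K"
    and \<phi>: "\<And>s. s \<in> M \<Longrightarrow> \<phi> s \<in> K" "\<And>s t. s \<in> M \<Longrightarrow> t \<in> M \<Longrightarrow> s \<subseteq> t \<Longrightarrow> \<phi> s \<subseteq> \<phi> t"
  shows "acyclic_carrier M K (\<lambda>s. faces (\<phi> s))"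
  unfolding acyclic_carrier_def subcomplex_def
proof (intro conjI ballI impI)
  fix s assume s: "s \<in> M"
  note fin = complexD(1,2)[OF K \<phi>(1)[OF s]]
  show "abstract_simplicial_complex (faces (\<phi> s))" by (rule complex_faces[OF fin(1)])
  show "faces (\<phi> s) \<subseteq> K" by (intro faces_subset K \<phi> s)
  show "faces (\<phi> s) \<noteq> {}" using self_in_faces[OF fin(2)] by blast
  show "contractible_complex (faces (\<phi> s))" by (rule contractible_faces[OF fin])
next
  fix s t assume "s \<in> M" "t \<in> M" "s \<subseteq> t"
  then show "faces (\<phi> s) \<subseteq> faces (\<phi> t)"
    by (intro faces_mono \<phi>)
qed

section \<open>Comparison of a complex with its subdivision\<close>

abbreviation to_sd :: "'v set set \<Rightarrow> 'v set set \<Rightarrow> (('v \<Rightarrow> real) \<Rightarrow> ('v set \<Rightarrow> real)) \<Rightarrow> bool"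
  where "to_sd K K' p \<equiv> map_carried K (sd K') (\<lambda>s. sd (faces s)) p"

abbreviation from_sd :: "'v set set \<Rightarrow> 'v set set \<Rightarrow> (('v set \<Rightarrow> real) \<Rightarrow> ('v \<Rightarrow> real)) \<Rightarrow> bool"
  where "from_sd K K' q \<equiv> map_carried (sd K) K' (\<lambda>c. faces (\<Union>c)) q"

lemma to_sd_exists:
  assumes "abstract_simplicial_complex K"
  obtains p where "to_sd K K p"
  using map_carried_exists[OF assms complex_sd acyclic_carrier_sd_faces[OF assms, of K "\<lambda>s. s"]] by blast

lemma from_sd_exists:
  assumes "abstract_simplicial_complex K"
  obtains q where "from_sd K K q"
  using map_carried_exists[OF complex_sd assms acyclic_carrier_faces[OF assms, of "sd K" Union]]
    sd_Union_Inter_in(1) by blast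

text \<open>Separate source and target complexes allow a map built for \<open>K\<close> to be
  compared with the restriction of one built for \<open>K'\<close>.\<close>

lemma to_sd_unique:
  assumes "abstract_simplicial_complex K" "abstract_simplicial_complex K'" "K \<subseteq> K'"
    and "to_sd K K' p" "to_sd K K' p'"
  shows "homotopic_with (\<lambda>_. True) (realization K) (realization (sd K')) p p'"
  by (rule map_carried_imp_homotopic[OF assms(1) complex_sd acyclic_carrier_sd_faces[OF assms(2)] assms(4,5)])
     (use assms(3) in auto)

lemma from_sd_unique:
  assumes "abstract_simplicial_complex K'" "K \<subseteq> K'"
    and "from_sd K K' q" "from_sd K K' q'"
  shows "homotopic_with (\<lambda>_. True) (realization (sd K)) (realization K') q q'"
  by (rule map_carried_imp_homotopic[OF complex_sd assms(1) acyclic_carrier_faces[OF assms(1)] assms(3,4)])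
     (use assms(2) sd_Union_Inter_in(1) in blast)+

text \<open>Each simplex \<open>s\<close> goes into \<open>sd (faces s)\<close> and back into
  \<open>faces s\<close>, so the composite and the identity share the carrier
  \<open>faces\<close>.\<close>

lemma from_to_sd:
  assumes K: "abstract_simplicial_complex K" and p: "to_sd K K p" and q: "from_sd K K q"
  shows "homotopic_with (\<lambda>_. True) (realization K) (realization K) (q \<circ> p) id"
proof (rule map_carried_imp_homotopic[OF K K acyclic_carrier_faces[OF K, of K "\<lambda>s. s"]])
  show "map_carried K K faces (q \<circ> p)"
  proof (rule map_carriedI)
    show "continuous_map (realization K) (realization K) (q \<circ> p)"
      by (rule continuous_map_compose[OF p[THEN map_carried_continuous] q[THEN map_carried_continuous]])
    fix s x assume s: "s \<in> K" "x \<in> closed_cell s"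
    then have "p x \<in> polyhedron (sd (faces s))"
      using p by (simp add: map_carried_def carried_def)
    then show "(q \<circ> p) x \<in> polyhedron (faces s)"
      unfolding o_apply
    proof (rule map_carried_polyhedron[OF q])
      fix c assume c: "c \<in> sd (faces s)"
      have "\<Union>c \<subseteq> s"
        using sd_Union_Inter_in(1)[OF c] unfolding faces_def by blast
      then show "c \<in> sd K \<and> faces (\<Union>c) \<subseteq> faces s"
        using subsetD[OF sd_mono[OF faces_subset[OF K s(1)]] c] by (simp add: faces_mono)
    qed
  qed
  show "map_carried K K faces id"
  proof (rule map_carriedI)
    fix s x assume "s \<in> K" "x \<in> closed_cell s"
    then show "id x \<in> polyhedron (faces s)"
      using closed_cell_in_polyhedron[OF self_in_faces[OF complexD(2)[OF K]]] by simp
  qed simp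
qed auto

text \<open>A chain goes into the faces of its greatest member and then into their subdivision,
  which contains the chain itself.\<close>

lemma to_from_sd:
  assumes K: "abstract_simplicial_complex K" and p: "to_sd K K p" and q: "from_sd K K q"
  shows "homotopic_with (\<lambda>_. True) (realization (sd K)) (realization (sd K)) (p \<circ> q) id"
proof (rule map_carried_imp_homotopic[OF complex_sd complex_sd acyclic_carrier_sd_faces[OF K, of "sd K" Union]])
  show "map_carried (sd K) (sd K) (\<lambda>c. sd (faces (\<Union>c))) (p \<circ> q)"
  proof (rule map_carriedI)
    show "continuous_map (realization (sd K)) (realization (sd K)) (p \<circ> q)"
      by (rule continuous_map_compose[OF q[THEN map_carried_continuous] p[THEN map_carried_continuous]])
    fix c x assume c: "c \<in> sd K" "x \<in> closed_cell c"
    then have "q x \<in> polyhedron (faces (\<Union>c))"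
      using q by (simp add: map_carried_def carried_def)
    then show "(p \<circ> q) x \<in> polyhedron (sd (faces (\<Union>c)))"
      unfolding o_apply
    proof (rule map_carried_polyhedron[OF p])
      fix s assume s: "s \<in> faces (\<Union>c)"
      then have "s \<subseteq> \<Union>c"
        unfolding faces_def by blast
      then show "s \<in> K \<and> sd (faces s) \<subseteq> sd (faces (\<Union>c))"
        using subsetD[OF faces_subset[OF K sd_Union_Inter_in(1)[OF c(1)]] s]
        by (simp add: sd_mono faces_mono)
    qed
  qed
  show "map_carried (sd K) (sd K) (\<lambda>c. sd (faces (\<Union>c))) id"
  proof (rule map_carriedI)
    fix c x assume c: "c \<in> sd K" "x \<in> closed_cell c"
    then have "c \<in> sd (faces (\<Union>c))"
      using complexD(2)[OF K] by (auto simp: sd_def faces_def)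
    then show "id x \<in> polyhedron (sd (faces (\<Union>c)))"
      using c(2) by (simp add: closed_cell_in_polyhedron)
  qed simp
qed (auto intro: sd_Union_Inter_in(1))

subsection \<open>The nerve of a finite cover\<close>

lemma homotopic_with_compose_both:
  assumes "homotopic_with (\<lambda>_. True) X2 X3 f g" "continuous_map X1 X2 h" "continuous_map X3 X4 k"
  shows "homotopic_with (\<lambda>_. True) X1 X4 (k \<circ> f \<circ> h) (k \<circ> g \<circ> h)"
  by (rule homotopic_with_compose_continuous_map_right
      [OF homotopic_with_compose_continuous_map_left[OF assms(1,3)] assms(2)]) simp_all

lemma complex_nerve: "abstract_simplicial_complex (nerve I A)"
  unfolding abstract_simplicial_complex_def
proof (intro conjI ballI allI impI)
  fix s t assume s: "s \<in> nerve I A" and t: "t \<subseteq> s \<and> t \<noteq> {}"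
  then have "(\<Inter>i\<in>s. A i) \<noteq> {}" "(\<Inter>i\<in>s. A i) \<subseteq> (\<Inter>i\<in>t. A i)"
    by (auto simp: nerve_def)
  then have "(\<Inter>i\<in>t. A i) \<noteq> {}"
    by blast
  then show "t \<in> nerve I A"
    using s t by (auto simp: nerve_def intro: finite_subset)
qed (simp_all add: nerve_def)

lemma nerve_mono:
  assumes "I \<subseteq> I'" "\<And>i. i \<in> I \<Longrightarrow> A i \<subseteq> A' i"
  shows "nerve I A \<subseteq> nerve I' A'"
proof
  fix \<sigma> assume "\<sigma> \<in> nerve I A"
  then have "\<sigma> \<subseteq> I" "finite \<sigma>" "\<sigma> \<noteq> {}" and "(\<Inter>i\<in>\<sigma>. A i) \<noteq> {}"
    by (simp_all add: nerve_def)
  moreover from this have "(\<Inter>i\<in>\<sigma>. A i) \<subseteq> (\<Inter>i\<in>\<sigma>. A' i)"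
    using assms(2) by (intro INF_mono) blast
  ultimately show "\<sigma> \<in> nerve I' A'"
    using assms(1) unfolding nerve_def by blast
qed

section \<open>Index sets of simplices and intersections of cover members\<close>

locale finite_subcomplex_cover =
  fixes K :: "'v set set" and I :: "'i set" and A :: "'i \<Rightarrow> 'v set set"
  assumes complex: "abstract_simplicial_complex K"
    and finite_I: "finite I"
    and cover: "subcomplex_cover K I A"
begin

abbreviation N :: "'i set set"
  where "N \<equiv> nerve I A"

definition members :: "'v set \<Rightarrow> 'i set"
  where "members s = {i \<in> I. s \<in> A i}"

lemma members_antimono:
  assumes "s \<subseteq> t" "s \<noteq> {}"
  shows "members t \<subseteq> members s"
proof
  fix i assume "i \<in> members t"
  then have i: "i \<in> I" "t \<in> A i" by (simp_all add: members_def)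
  then have "abstract_simplicial_complex (A i)"
    using cover by (simp add: subcomplex_cover_def subcomplex_def)
  from complexD(3)[OF this i(2) assms] show "i \<in> members s"
    using i by (simp add: members_def)
qed

text \<open>The simplex \<open>s\<close> itself witnesses that the intersection is nonempty;
  covering provides an index, and \<open>I\<close> is finite.\<close>

lemma members_in_nerve:
  assumes "s \<in> K"
  shows "members s \<in> N"
proof -
  obtain i where "i \<in> I" "s \<in> A i"
    using cover assms by (auto simp: subcomplex_cover_def)
  moreover have "s \<in> (\<Inter>i\<in>members s. A i)"
    by (simp add: members_def)
  ultimately show ?thesis
    using finite_I by (auto simp: nerve_def members_def)
qed

text \<open>Reversing inclusions takes chains to chains. The sets \<open>L\<close> and
  \<open>P\<close> localise the statement, which is applied both to all of \<open>K\<close> and to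
  intersections of cover members.\<close>

lemma members_image_sd:
  assumes "c \<in> sd L" "L \<subseteq> K" "\<And>s. s \<in> L \<Longrightarrow> members s \<in> P"
  shows "members ` c \<in> sd P"
proof -
  have c: "finite c" "c \<noteq> {}" "c \<subseteq> L" "\<forall>a\<in>c. \<forall>b\<in>c. a \<subseteq> b \<or> b \<subseteq> a"
    using assms(1) by (simp_all add: sd_def)
  have "members a \<subseteq> members b \<or> members b \<subseteq> members a" if "a \<in> c" "b \<in> c" for a b
  proof -
    have "a \<noteq> {}" "b \<noteq> {}"
      using that c(3) assms(2) complexD(2)[OF complex] by blast+
    then show ?thesis
      using c(4) that members_antimono by metis
  qed
  then show ?thesis
    using c assms(3) by (auto simp: sd_def)
qed

lemma continuous_realization_map_members:
  "continuous_map (realization (sd K)) (realization (sd N)) (realization_map members)"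
  by (intro continuous_map_realization_map complex_sd members_image_sd[OF _ subset_refl] members_in_nerve)

lemma realization_map_members_in_cell:
  "c \<in> sd K \<Longrightarrow> x \<in> closed_cell c \<Longrightarrow> realization_map members x \<in> closed_cell (members ` c)"
  by (rule realization_map_in_cell(1)) (simp add: sd_def)

text \<open>Over the empty index set this is \<open>UNIV\<close>, so the facts that place it inside
  \<open>K\<close> ask for \<open>\<sigma> \<in> N\<close>.\<close>

definition common :: "'i set \<Rightarrow> 'v set set"
  where "common \<sigma> = (\<Inter>i\<in>\<sigma>. A i)"

lemma common_antimono: "\<sigma> \<subseteq> \<tau> \<Longrightarrow> common \<tau> \<subseteq> common \<sigma>"
  by (auto simp: common_def)

lemma common_subset:
  assumes "\<sigma> \<in> N"
  shows "common \<sigma> \<subseteq> K"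
proof -
  obtain i where "i \<in> \<sigma>" "i \<in> I"
    using assms by (auto simp: nerve_def)
  then show ?thesis
    using cover by (auto simp: subcomplex_cover_def common_def)
qed

lemma subcomplex_common:
  assumes "\<sigma> \<in> N"
  shows "subcomplex (common \<sigma>) K"
proof -
  have "abstract_simplicial_complex (A i)" if "i \<in> \<sigma>" for i
    using assms that cover by (auto simp: nerve_def subcomplex_cover_def subcomplex_def)
  then have sub: "t \<in> A i" if "i \<in> \<sigma>" "s \<in> A i" "t \<subseteq> s" "t \<noteq> {}" for i s t
    using complexD(3) that by metis
  have "abstract_simplicial_complex (common \<sigma>)"
    unfolding abstract_simplicial_complex_def
  proof (intro conjI ballI allI impI)
    fix s assume "s \<in> common \<sigma>"
    then have "s \<in> K" using common_subset[OF assms] by blast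
    then show "finite s" "s \<noteq> {}" by (rule complexD[OF complex])+
  next
    fix s t assume "s \<in> common \<sigma>" "t \<subseteq> s \<and> t \<noteq> {}"
    then show "t \<in> common \<sigma>"
      unfolding common_def using sub[of _ s t] by simp
  qed
  then show ?thesis
    using common_subset[OF assms] by (simp add: subcomplex_def)
qed

text \<open>This and the next fact come from the antitone Galois correspondence \<open>s \<in>
  common \<sigma> \<longleftrightarrow> \<sigma> \<subseteq> members s\<close> for
  \<open>\<sigma> \<in> N\<close>.\<close>

lemma in_common_members: "s \<in> K \<Longrightarrow> s \<in> common (members s)"
  by (simp add: common_def members_def)

lemma common_imp_members: "\<sigma> \<in> N \<Longrightarrow> s \<in> common \<sigma> \<Longrightarrow> \<sigma> \<subseteq> members s"
  by (auto simp: common_def members_def nerve_def)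

end

section \<open>Nerve equivalence for contractible intersections\<close>

locale good_cover = finite_subcomplex_cover +
  assumes contractible_common: "\<sigma> \<in> N \<Longrightarrow> contractible_complex (common \<sigma>)"
begin

text \<open>Passing from \<open>c\<close> to an index set and from there to the intersection
  reverses inclusions twice, so the result is monotone as a carrier must be.\<close>

lemma acyclic_carrier_common:
  assumes "\<And>c. c \<in> M \<Longrightarrow> \<phi> c \<in> N" "\<And>c d. c \<in> M \<Longrightarrow> d \<in> M \<Longrightarrow> c \<subseteq> d \<Longrightarrow> \<phi> d \<subseteq> \<phi> c"
  shows "acyclic_carrier M K (\<lambda>c. common (\<phi> c))"
  unfolding acyclic_carrier_def
  using assms subcomplex_common contractible_common common_antimono
  by (auto simp: common_def nerve_def)

lemma homotopic_common_members:
  assumes g: "map_carried (sd N) K (\<lambda>c. common (\<Inter>c)) g" and q: "from_sd K K q"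
  shows "homotopic_with (\<lambda>_. True) (realization (sd K)) (realization K) (g \<circ> realization_map members) q"
proof (rule map_carried_imp_homotopic[OF complex_sd complex])
  let ?\<Phi> = "\<lambda>c. common (members (\<Union>c))"
  show "acyclic_carrier (sd K) K ?\<Phi>"
  proof (rule acyclic_carrier_common)
    fix c d assume "c \<in> sd K" "d \<in> sd K" "c \<subseteq> d"
    then show "members (\<Union>d) \<subseteq> members (\<Union>c)"
      by (intro members_antimono Union_mono complexD(2)[OF complex] sd_Union_Inter_in(1))
  qed (intro members_in_nerve sd_Union_Inter_in(1))
  show "map_carried (sd K) K ?\<Phi> (g \<circ> realization_map members)"
  proof (rule map_carriedI)
    show "continuous_map (realization (sd K)) (realization K) (g \<circ> realization_map members)"
      by (rule continuous_map_compose[OF continuous_realization_map_members map_carried_continuous[OF g]])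
    fix c x assume c: "c \<in> sd K" "x \<in> closed_cell c"
    have mc: "members ` c \<in> sd N"
      using c(1) members_in_nerve by (intro members_image_sd[of _ K]) auto
    have gx: "g (realization_map members x) \<in> polyhedron (common (\<Inter>(members ` c)))"
      using g mc realization_map_members_in_cell[OF c] by (simp add: map_carried_def carried_def)
    \<comment> \<open>As inclusions are reversed, the greatest member of \<open>c\<close> has the
      least index set, so the intersection carrying \<open>g\<close> lies in
      \<open>?\<Phi> c\<close>.\<close>
    have "members (\<Union>c) \<subseteq> \<Inter>(members ` c)"
    proof (rule INT_greatest)
      fix s assume s: "s \<in> c"
      then have "s \<in> K" using c(1) by (auto simp: sd_def)
      then show "members (\<Union>c) \<subseteq> members s"
        using s complexD(2)[OF complex] by (intro members_antimono) auto
    qed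
    from topspace_realization_mono[OF common_antimono[OF this]]
    show "(g \<circ> realization_map members) x \<in> polyhedron (?\<Phi> c)"
      unfolding o_apply using gx by (rule subsetD)
  qed
  show "map_carried (sd K) K ?\<Phi> q"
  proof (rule map_carriedI[OF map_carried_continuous[OF q]])
    fix c x assume c: "c \<in> sd K" "x \<in> closed_cell c"
    note U = sd_Union_Inter_in(1)[OF c(1)]
    have "faces (\<Union>c) \<subseteq> ?\<Phi> c"
      using subcomplex_common[OF members_in_nerve[OF U]] in_common_members[OF U]
      by (intro faces_subset) (simp_all add: subcomplex_def)
    moreover have "q x \<in> polyhedron (faces (\<Union>c))"
      using q c by (simp add: map_carried_def carried_def)
    ultimately show "q x \<in> polyhedron (?\<Phi> c)"
      using topspace_realization_mono by blast
  qed
qed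

lemma homotopic_members_common:
  assumes g: "map_carried (sd N) K (\<lambda>c. common (\<Inter>c)) g" and p: "to_sd K K p"
  shows "homotopic_with (\<lambda>_. True) (realization (sd N)) (realization (sd N))
    (realization_map members \<circ> p \<circ> g) id"
proof (rule map_carried_imp_homotopic[OF complex_sd complex_sd])
  \<comment> \<open>A longer chain has a smaller least member, so the set of simplices above it
    grows, as monotonicity requires. This set is merely an up-set of the nerve, but its chains form
    a complex, a cone with apex \<open>\<Inter>c\<close>.\<close>
  let ?\<Phi> = "\<lambda>c. sd {\<tau> \<in> N. \<Inter>c \<subseteq> \<tau>}"
  show "acyclic_carrier (sd N) (sd N) ?\<Phi>"
    unfolding acyclic_carrier_def subcomplex_def
  proof (intro conjI ballI impI complex_sd)
    fix c assume "c \<in> sd N"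
    then have *: "\<Inter>c \<in> {\<tau> \<in> N. \<Inter>c \<subseteq> \<tau>}"
      using sd_Union_Inter_in(2) by blast
    show "?\<Phi> c \<noteq> {}" using singleton_in_sd[OF *] by blast
    show "contractible_complex (?\<Phi> c)" by (rule contractible_sd[OF *]) simp
    show "?\<Phi> c \<subseteq> sd N" by (rule sd_mono) simp
  next
    fix c d :: "'b set set" assume "c \<subseteq> d"
    then have "\<Inter>d \<subseteq> \<Inter>c" by blast
    then show "?\<Phi> c \<subseteq> ?\<Phi> d" by (intro sd_mono) auto
  qed
  show "map_carried (sd N) (sd N) ?\<Phi> (realization_map members \<circ> p \<circ> g)"
  proof (rule map_carriedI)
    show "continuous_map (realization (sd N)) (realization (sd N)) (realization_map members \<circ> p \<circ> g)"
      by (rule continuous_map_compose[OF g[THEN map_carried_continuous]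
            continuous_map_compose[OF p[THEN map_carried_continuous] continuous_realization_map_members]])
    fix c x assume c: "c \<in> sd N" "x \<in> closed_cell c"
    note N = sd_Union_Inter_in(2)[OF c(1)]
    have "g x \<in> polyhedron (common (\<Inter>c))"
      using g c by (simp add: map_carried_def carried_def)
    then have "p (g x) \<in> polyhedron (sd (common (\<Inter>c)))"
    proof (rule map_carried_polyhedron[OF p])
      fix s assume "s \<in> common (\<Inter>c)"
      then show "s \<in> K \<and> sd (faces s) \<subseteq> sd (common (\<Inter>c))"
        using subcomplex_common[OF N] by (auto simp: subcomplex_def intro: sd_mono[OF faces_subset, THEN subsetD])
    qed
    then obtain d where d: "d \<in> sd (common (\<Inter>c))" "p (g x) \<in> closed_cell d"
      by (auto simp: topspace_realization)
    \<comment> \<open>A simplex in the intersection over \<open>\<Inter>c\<close> lies in all cover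
      members indexed there, so its own index set is above \<open>\<Inter>c\<close>.\<close>
    have "members ` d \<in> ?\<Phi> c"
    proof (rule members_image_sd[OF d(1) common_subset[OF N]])
      fix s assume "s \<in> common (\<Inter>c)"
      then show "members s \<in> {\<tau> \<in> N. \<Inter>c \<subseteq> \<tau>}"
        using common_subset[OF N] common_imp_members[OF N] members_in_nerve by simp blast
    qed
    moreover have "realization_map members (p (g x)) \<in> closed_cell (members ` d)"
      using d sd_mono[OF common_subset[OF N]] by (intro realization_map_members_in_cell) auto
    ultimately show "(realization_map members \<circ> p \<circ> g) x \<in> polyhedron (?\<Phi> c)"
      unfolding o_apply by (rule closed_cell_in_polyhedron)
  qed
  show "map_carried (sd N) (sd N) ?\<Phi> id"
  proof (rule map_carriedI)
    fix c x assume c: "c \<in> sd N" "x \<in> closed_cell c"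
    then have "c \<in> ?\<Phi> c" by (auto simp: sd_def)
    then show "id x \<in> polyhedron (?\<Phi> c)"
      using c by (simp add: closed_cell_in_polyhedron)
  qed simp
qed

lemma nerve_equivalence:
  assumes p: "to_sd K K p" and q: "from_sd N N q"
  shows "homotopy_equivalence_map (realization K) (realization N) (q \<circ> realization_map members \<circ> p)"
proof -
  let ?m = "realization_map members"
  \<comment> \<open>Up to homotopy \<open>q'\<close> and \<open>p'\<close> invert \<open>p\<close>
    and \<open>q\<close>; the homotopy inverse of the composite will be
    \<open>g \<circ> p'\<close>.\<close>
  obtain q' where q': "from_sd K K q'" by (rule from_sd_exists[OF complex])
  obtain p' where p': "to_sd N N p'" by (rule to_sd_exists[OF complex_nerve])
  have "acyclic_carrier (sd N) K (\<lambda>c. common (\<Inter>c))"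
    by (rule acyclic_carrier_common) (auto intro: sd_Union_Inter_in(2))
  then obtain g where g: "map_carried (sd N) K (\<lambda>c. common (\<Inter>c)) g"
    by (rule map_carried_exists[OF complex_sd complex])
  note cont = p[THEN map_carried_continuous] q[THEN map_carried_continuous]
    p'[THEN map_carried_continuous] q'[THEN map_carried_continuous]
    g[THEN map_carried_continuous] continuous_realization_map_members
  have cmp: "continuous_map (realization K) (realization (sd N)) (?m \<circ> p)"
    by (rule continuous_map_compose[OF cont(1,6)])
  have cf: "continuous_map (realization K) (realization N) (q \<circ> ?m \<circ> p)"
    by (rule continuous_map_compose[OF cont(1) continuous_map_compose[OF cont(6,2)]])
  have cg: "continuous_map (realization N) (realization K) (g \<circ> p')"
    by (rule continuous_map_compose[OF cont(3,5)])
  have fg: "homotopic_with (\<lambda>_. True) (realization N) (realization N)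
      (q \<circ> (?m \<circ> p \<circ> g) \<circ> p') (q \<circ> id \<circ> p')"
    by (rule homotopic_with_compose_both[OF homotopic_members_common[OF g p] cont(3) cont(2)])
  \<comment> \<open>The composite on \<open>K\<close> collapses from the middle outwards:
    \<open>p' \<circ> q\<close> cancels, then \<open>g \<circ> ?m\<close> becomes \<open>q'\<close>,
    and finally \<open>q' \<circ> p\<close> is homotopic to the identity.\<close>
  have gf1: "homotopic_with (\<lambda>_. True) (realization K) (realization K)
      (g \<circ> (p' \<circ> q) \<circ> (?m \<circ> p)) (g \<circ> id \<circ> (?m \<circ> p))"
    by (rule homotopic_with_compose_both[OF to_from_sd[OF complex_nerve p' q] cmp cont(5)])
  have gf2: "homotopic_with (\<lambda>_. True) (realization K) (realization K)
      (id \<circ> (g \<circ> ?m) \<circ> p) (id \<circ> q' \<circ> p)"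
    by (rule homotopic_with_compose_both[OF homotopic_common_members[OF g q'] cont(1) continuous_map_id])
  have "homotopic_with (\<lambda>_. True) (realization K) (realization K) (g \<circ> p' \<circ> (q \<circ> ?m \<circ> p)) id"
    using homotopic_with_trans[OF gf1[unfolded o_assoc comp_id]
        homotopic_with_trans[OF gf2[unfolded o_assoc id_comp] from_to_sd[OF complex p q']]]
    unfolding o_assoc .
  moreover have "homotopic_with (\<lambda>_. True) (realization N) (realization N) (q \<circ> ?m \<circ> p \<circ> (g \<circ> p')) id"
    using homotopic_with_trans[OF fg[unfolded o_assoc comp_id] from_to_sd[OF complex_nerve p' q]]
    unfolding o_assoc .
  ultimately show ?thesis
    unfolding homotopy_equivalence_map_def using cf cg by blast
qed

end

text \<open>Both maps send a chain \<open>c\<close> into the faces of \<open>c'.members (\<Inter>c)\<close>, where \<open>\<Inter>c\<close> is the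
  least simplex of \<open>c\<close>.\<close>

lemma homotopic_members_mono:
  assumes c: "finite_subcomplex_cover K I A" and c': "finite_subcomplex_cover K' I' A'"
    and sub: "K \<subseteq> K'" "I \<subseteq> I'" "\<And>i. i \<in> I \<Longrightarrow> A i \<subseteq> A' i"
  shows "homotopic_with (\<lambda>_. True) (realization (sd K)) (realization (sd (nerve I' A')))
    (realization_map (finite_subcomplex_cover.members I' A'))
    (realization_map (finite_subcomplex_cover.members I A))"
proof -
  interpret c: finite_subcomplex_cover K I A by (rule c)
  interpret c': finite_subcomplex_cover K' I' A' by (rule c')
  let ?\<phi> = "\<lambda>c. c'.members (\<Inter>c)"
  have N: "c.N \<subseteq> c'.N"
    using sub(2,3) by (rule nerve_mono)
  have mem: "c.members s \<subseteq> c'.members s" for s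
    using sub by (auto simp: c.members_def c'.members_def)
  \<comment> \<open>Stated for any vertex map \<open>m\<close> with values below
    \<open>c'.members\<close>, so that it applies to the index sets of both covers.\<close>
  have carried: "map_carried (sd K) (sd c'.N) (\<lambda>c. sd (faces (?\<phi> c))) (realization_map m)"
    if m: "\<And>c. c \<in> sd K \<Longrightarrow> m ` c \<in> sd c'.N" "\<And>s. m s \<subseteq> c'.members s" for m
  proof (rule map_carriedI)
    show "continuous_map (realization (sd K)) (realization (sd c'.N)) (realization_map m)"
      by (rule continuous_map_realization_map[OF complex_sd m(1)])
    fix c x assume c: "c \<in> sd K" "x \<in> closed_cell c"
    have "m s \<in> faces (?\<phi> c)" if s: "s \<in> c" for s
    proof -
      have "\<Inter>c \<noteq> {}"
        using sd_Union_Inter_in(2)[OF c(1)] complexD(2)[OF c.complex] by blast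
      then have "m s \<subseteq> ?\<phi> c"
        using m(2)[of s] c'.members_antimono[of "\<Inter>c" s] s by blast
      moreover have "m s \<in> c'.N"
        using m(1)[OF c(1)] s by (auto simp: sd_def)
      ultimately show ?thesis
        by (auto simp: faces_def nerve_def)
    qed
    then have "m ` c \<in> sd (faces (?\<phi> c))"
      using m(1)[OF c(1)] by (auto simp: sd_def)
    moreover have "realization_map m x \<in> closed_cell (m ` c)"
      using c by (intro realization_map_in_cell) (simp_all add: sd_def)
    ultimately show "realization_map m x \<in> polyhedron (sd (faces (?\<phi> c)))"
      by (rule closed_cell_in_polyhedron)
  qed
  show ?thesis
  proof (rule map_carried_imp_homotopic[OF complex_sd complex_sd])
    show "acyclic_carrier (sd K) (sd c'.N) (\<lambda>c. sd (faces (?\<phi> c)))"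
    proof (rule acyclic_carrier_sd_faces[OF complex_nerve])
      show "?\<phi> c \<in> c'.N" if "c \<in> sd K" for c
        using sd_Union_Inter_in(2)[OF that] sub(1) by (intro c'.members_in_nerve) blast
      show "?\<phi> c \<subseteq> ?\<phi> d" if "c \<in> sd K" "d \<in> sd K" "c \<subseteq> d" for c d
        using that complexD(2)[OF c.complex sd_Union_Inter_in(2)[OF that(2)]]
        by (intro c'.members_antimono Inter_anti_mono)
    qed
    show "map_carried (sd K) (sd c'.N) (\<lambda>c. sd (faces (?\<phi> c))) (realization_map c'.members)"
    proof (rule carried)
      show "c'.members ` c \<in> sd c'.N" if "c \<in> sd K" for c
        using that sub(1) by (intro c'.members_image_sd[of c K] c'.members_in_nerve) auto
    qed simp
    show "map_carried (sd K) (sd c'.N) (\<lambda>c. sd (faces (?\<phi> c))) (realization_map c.members)"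
    proof (rule carried[OF _ mem])
      fix c assume "c \<in> sd K"
      then have "c.members ` c \<in> sd c.N"
        by (intro c.members_image_sd[of c K] c.members_in_nerve) auto
      then show "c.members ` c \<in> sd c'.N"
        using sd_mono[OF N] by blast
    qed
  qed
qed

section \<open>Assembling the commuting square\<close>

lemma nerve_maps_commute:
  assumes c: "finite_subcomplex_cover K I A" and c': "finite_subcomplex_cover K' I' A'"
    and sub: "K \<subseteq> K'" "I \<subseteq> I'" "\<And>i. i \<in> I \<Longrightarrow> A i \<subseteq> A' i"
    and p: "to_sd K K p" "to_sd K' K' p'"
    and q: "from_sd (nerve I A) (nerve I A) q" "from_sd (nerve I' A') (nerve I' A') q'"
  shows "homotopic_with (\<lambda>_. True) (realization K) (realization (nerve I' A'))
    (q' \<circ> realization_map (finite_subcomplex_cover.members I' A') \<circ> p')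
    (q \<circ> realization_map (finite_subcomplex_cover.members I A) \<circ> p)"
proof -
  interpret c: finite_subcomplex_cover K I A by (rule c)
  interpret c': finite_subcomplex_cover K' I' A' by (rule c')
  let ?m = "realization_map c.members" and ?m' = "realization_map c'.members"
  have N: "c.N \<subseteq> c'.N"
    using sub(2,3) by (rule nerve_mono)
  \<comment> \<open>The carriers \<open>sd (faces s)\<close> and \<open>faces (\<Union>c)\<close> do
    not mention the ambient complexes, so maps stay carried when the source shrinks and the target
    grows.\<close>
  have restrict: "map_carried M Q \<Phi> f"
    if "map_carried M' Q' \<Phi> f" "M \<subseteq> M'" "Q' \<subseteq> Q" for M M' Q Q' \<Phi> and f :: "('x \<Rightarrow> real) \<Rightarrow> 'y \<Rightarrow> real"
  proof -
    have "continuous_map (realization M) (realization Q) (id \<circ> (f \<circ> id))"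
      using that by (intro continuous_map_compose[OF continuous_map_compose])
        (auto intro: continuous_map_subcomplex map_carried_continuous)
    then show ?thesis
      using that by (auto simp: map_carried_def carried_def)
  qed
  have pK: "to_sd K K' p" "to_sd K K' p'"
    using restrict[OF p(1)] restrict[OF p(2)] sub(1) sd_mono[OF sub(1)] by blast+
  have qN: "from_sd c.N c'.N q" "from_sd c.N c'.N q'"
    using restrict[OF q(1)] restrict[OF q(2)] N sd_mono[OF N] by blast+
  note cont = p[THEN map_carried_continuous] q[THEN map_carried_continuous]
  \<comment> \<open>The three factors are exchanged one at a time: \<open>p'\<close> becomes
    \<open>p\<close>, then \<open>?m'\<close> becomes \<open>?m\<close>, then \<open>q'\<close>
    becomes \<open>q\<close>.\<close>
  have "continuous_map (realization (sd K')) (realization c'.N) (q' \<circ> ?m')"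
    by (rule continuous_map_compose[OF c'.continuous_realization_map_members cont(4)])
  with to_sd_unique[OF c.complex c'.complex sub(1) pK(2,1)]
  have h1: "homotopic_with (\<lambda>_. True) (realization K) (realization c'.N) (q' \<circ> ?m' \<circ> p') (q' \<circ> ?m' \<circ> p)"
    by (rule homotopic_with_compose_continuous_map_left) simp
  have h2: "homotopic_with (\<lambda>_. True) (realization K) (realization c'.N) (q' \<circ> ?m' \<circ> p) (q' \<circ> ?m \<circ> p)"
    by (rule homotopic_with_compose_both[OF homotopic_members_mono[OF c c' sub] cont(1) cont(4)])
  have h3: "homotopic_with (\<lambda>_. True) (realization K) (realization c'.N) (q' \<circ> (?m \<circ> p)) (q \<circ> (?m \<circ> p))"
    using from_sd_unique[OF complex_nerve N qN(2,1)]
      continuous_map_compose[OF cont(1) c.continuous_realization_map_members]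
    by (rule homotopic_with_compose_continuous_map_right) simp
  show ?thesis
    by (rule homotopic_with_trans[OF h1 homotopic_with_trans[OF h2 h3[unfolded o_assoc]]])
qed

text \<open>Simplices of the nerve index nonempty intersections, so of the two alternatives only
  contractibility remains.\<close>

lemma good_coverI:
  assumes "abstract_simplicial_complex K" "finite I" "subcomplex_cover K I A"
    and "\<And>\<sigma>. \<sigma> \<subseteq> I \<Longrightarrow> finite \<sigma> \<Longrightarrow> \<sigma> \<noteq> {} \<Longrightarrow>
      (\<Inter>i\<in>\<sigma>. A i) = {} \<or> contractible_complex (\<Inter>i\<in>\<sigma>. A i)"
  shows "good_cover K I A"
proof -
  interpret finite_subcomplex_cover K I A
    by unfold_locales (use assms in auto)
  show ?thesis
    by unfold_locales (use assms(4) in \<open>auto simp: common_def nerve_def\<close>)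
qed

theorem theorem26:
  fixes K K' :: "'v set set"
    and I I' :: "'i set"
    and A A' :: "'i \<Rightarrow> 'v set set"
  assumes "abstract_simplicial_complex K" and "abstract_simplicial_complex K'"
    and "K \<subseteq> K'"
    and "finite I'" and "I \<subseteq> I'"
    and "subcomplex_cover K I A" and "subcomplex_cover K' I' A'"
    and "\<And>i. i \<in> I \<Longrightarrow> A i \<subseteq> A' i"
    and "\<And>\<sigma>. \<sigma> \<subseteq> I \<Longrightarrow> finite \<sigma> \<Longrightarrow> \<sigma> \<noteq> {} \<Longrightarrow>
           (\<Inter>i\<in>\<sigma>. A i) = {} \<or> contractible_complex (\<Inter>i\<in>\<sigma>. A i)"
    and "\<And>\<sigma>. \<sigma> \<subseteq> I' \<Longrightarrow> finite \<sigma> \<Longrightarrow> \<sigma> \<noteq> {} \<Longrightarrow>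
           (\<Inter>i\<in>\<sigma>. A' i) = {} \<or> contractible_complex (\<Inter>i\<in>\<sigma>. A' i)"
  shows "\<exists>f f'.
    homotopy_equivalence_map (realization K) (realization (nerve I A)) f \<and>
    homotopy_equivalence_map (realization K') (realization (nerve I' A')) f' \<and>
    homotopic_with (\<lambda>_. True) (realization K) (realization (nerve I' A'))
      (f' \<circ> realization_map id) (realization_map id \<circ> f)"
proof -
  have "finite I"
    using assms(4,5) by (rule finite_subset[rotated])
  interpret c: good_cover K I A
    by (rule good_coverI[OF assms(1) \<open>finite I\<close> assms(6,9)])
  interpret c': good_cover K' I' A'
    by (rule good_coverI[OF assms(2,4,7,10)])
  \<comment> \<open>The same four maps serve for the equivalences and for the square, as
    \<open>nerve_equivalence\<close> holds for every choice of them.\<close>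
  obtain p where p: "to_sd K K p" by (rule to_sd_exists[OF assms(1)])
  obtain p' where p': "to_sd K' K' p'" by (rule to_sd_exists[OF assms(2)])
  obtain q where q: "from_sd c.N c.N q" by (rule from_sd_exists[OF complex_nerve])
  obtain q' where q': "from_sd c'.N c'.N q'" by (rule from_sd_exists[OF complex_nerve])
  have "homotopic_with (\<lambda>_. True) (realization K) (realization c'.N)
      (q' \<circ> realization_map c'.members \<circ> p') (q \<circ> realization_map c.members \<circ> p)"
    by (rule nerve_maps_commute[OF c.finite_subcomplex_cover_axioms c'.finite_subcomplex_cover_axioms
          assms(3,5,8) p p' q q'])
  \<comment> \<open>Both inclusions are induced by \<open>id\<close> and hence are identities on
    points, so the square is exactly the homotopy just obtained.\<close>
  then show ?thesis
    unfolding realization_map_id comp_id id_comp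
    using c.nerve_equivalence[OF p q] c'.nerve_equivalence[OF p' q'] by blast
qed

end
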